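(* Let $W$ be a primitive $\omega$-Stone space. Then the partition formed by the atoms of $\mathscr{U}(W)$ is equal to $\mathscr{O}(W)$, and $\mathscr{U}(W)=Fi(W)$.
   Context: A Stone space $W$ is a locally compact Hausdorff space with a base of compact open sets (the Stone space of a Boolean ring, possibly without $1$); it is an $\omega$-Stone space if $R=\mathrm{Co}(W)$, the Boolean ring of compact open subsets, is countable. For $A\in R$ let $(A)=\{C\in R: C\subseteq A\}$; $A$ is pseudo-indecomposable (PI) if for all $B\in R$ with $B\subseteq A$, $(B)\cong(A)$ or $(A-B)\cong(A)$. $W$ is primitive if every element of $R$ is the disjoint union of finitely many PI elements. The prime TBA (prime topological Boolean algebra) $\mathscr{U}(W)$ is the smallest complete sub-TBA of $2^W$, i.e. the smallest family of subsets of $W$ closed under the (infinite) Boolean operations (arbitrary unions, arbitrary intersections and complements) and under the derived set operation $S\mapsto S'$, where $S'$ is the set of limit points of $S$. $Fi(W)$ is the set of subsets of $W$ invariant under all homeomorphisms $W\to W$. $\mathscr{O}(W)$ is the set of orbits of points of $W$ under homeomorphisms $W\to W$. *)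

theory Defs
  imports "HOL-Analysis.Abstract_Topological_Spaces" "HOL-Algebra.QuotRing"
    "HOL-Library.Countable_Set" "HOL-Library.Disjoint_Sets"
begin

section \<open>Stone spaces of Boolean rings\<close>

definition compact_opens :: "'a topology \<Rightarrow> 'a set set"
  where "compact_opens W = {K. compactin W K \<and> openin W K}"

definition stone_space :: "'a topology \<Rightarrow> bool"
  where "stone_space W \<longleftrightarrow>
     locally_compact_space W \<and> Hausdorff_space W \<and>
     (\<forall>U. openin W U \<longrightarrow> (\<exists>\<K>. \<K> \<subseteq> compact_opens W \<and> \<Union>\<K> = U))"

definition omega_stone_space :: "'a topology \<Rightarrow> bool"
  where "omega_stone_space W \<longleftrightarrow> stone_space W \<and> countable (compact_opens W)"


section \<open>Primitive spaces\<close>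

text \<open>For compact open \<open>A\<close>, the ideal \<open>(A)\<close> has the identity \<open>A\<close>, so it is a ring in the sense
  of HOL-Algebra even when the ring of all compact open sets has no identity. The relation
  \<open>(\<simeq>)\<close> below is ring isomorphism from HOL-Algebra.\<close>

definition compact_open_ideal :: "'a topology \<Rightarrow> 'a set \<Rightarrow> 'a set ring"
  where "compact_open_ideal W A =
     \<lparr>carrier = {C \<in> compact_opens W. C \<subseteq> A}, mult = (\<inter>), one = A,
      zero = {}, add = sym_diff\<rparr>"

definition pseudo_indecomposable :: "'a topology \<Rightarrow> 'a set \<Rightarrow> bool"
  where "pseudo_indecomposable W A \<longleftrightarrow>
     A \<in> compact_opens W \<and>
     (\<forall>B \<in> compact_opens W. B \<subseteq> A \<longrightarrow>
        compact_open_ideal W B \<simeq> compact_open_ideal W A \<or>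
        compact_open_ideal W (A - B) \<simeq> compact_open_ideal W A)"

definition primitive_space :: "'a topology \<Rightarrow> bool"
  where "primitive_space W \<longleftrightarrow>
     (\<forall>A \<in> compact_opens W. \<exists>\<F>. finite \<F> \<and> disjoint \<F> \<and>
        (\<forall>P \<in> \<F>. pseudo_indecomposable W P) \<and> \<Union>\<F> = A)"


section \<open>The prime topological Boolean algebra\<close>

text \<open>The intersection with \<^term>\<open>topspace W\<close> only matters for the empty family, whose
  intersection within \<open>W\<close> is the whole space.\<close>

definition complete_sub_TBA :: "'a topology \<Rightarrow> 'a set set \<Rightarrow> bool"
  where "complete_sub_TBA W \<B> \<longleftrightarrow>
     \<B> \<subseteq> Pow (topspace W) \<and>
     (\<forall>\<S>. \<S> \<subseteq> \<B> \<longrightarrow> \<Union>\<S> \<in> \<B>) \<and>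
     (\<forall>\<S>. \<S> \<subseteq> \<B> \<longrightarrow> topspace W \<inter> \<Inter>\<S> \<in> \<B>) \<and>
     (\<forall>S \<in> \<B>. topspace W - S \<in> \<B>) \<and>
     (\<forall>S \<in> \<B>. W derived_set_of S \<in> \<B>)"

definition prime_TBA :: "'a topology \<Rightarrow> 'a set set"
  where "prime_TBA W = \<Inter>{\<B>. complete_sub_TBA W \<B>}"

definition set_atoms :: "'a set set \<Rightarrow> 'a set set"
  where "set_atoms \<B> = {A \<in> \<B>. A \<noteq> {} \<and> (\<forall>B \<in> \<B>. B \<subseteq> A \<longrightarrow> B = {} \<or> B = A)}"


section \<open>Homeomorphism invariants\<close>

definition homeo_invariant_sets :: "'a topology \<Rightarrow> 'a set set"
  where "homeo_invariant_sets W =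
     {S. S \<subseteq> topspace W \<and> (\<forall>f. homeomorphic_map W W f \<longrightarrow> f ` S = S)}"

definition homeo_orbits :: "'a topology \<Rightarrow> 'a set set"
  where "homeo_orbits W = (\<lambda>x. {f x | f. homeomorphic_map W W f}) ` topspace W"


section \<open>Sanity checks\<close>

lemma complete_sub_TBA_Pow: "complete_sub_TBA W (Pow (topspace W))"
  unfolding complete_sub_TBA_def using derived_set_of_subset_topspace[of W] by auto

lemma complete_sub_TBA_prime_TBA: "complete_sub_TBA W (prime_TBA W)"
proof -
  have "prime_TBA W \<subseteq> Pow (topspace W)"
    unfolding prime_TBA_def using complete_sub_TBA_Pow by blast
  then show ?thesis
    unfolding complete_sub_TBA_def[of W "prime_TBA W"]
  proof (intro conjI allI impI ballI)
    fix \<S> assume S: "\<S> \<subseteq> prime_TBA W"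
    have "\<S> \<subseteq> \<B>" if "complete_sub_TBA W \<B>" for \<B>
      using S that unfolding prime_TBA_def by blast
    then show "\<Union>\<S> \<in> prime_TBA W" "topspace W \<inter> \<Inter>\<S> \<in> prime_TBA W"
      unfolding prime_TBA_def complete_sub_TBA_def by simp_all
  next
    fix S assume "S \<in> prime_TBA W"
    then show "topspace W - S \<in> prime_TBA W" "W derived_set_of S \<in> prime_TBA W"
      unfolding prime_TBA_def complete_sub_TBA_def by simp_all
  qed
qed

lemma prime_TBA_least: "complete_sub_TBA W \<B> \<Longrightarrow> prime_TBA W \<subseteq> \<B>"
  unfolding prime_TBA_def by blast

lemma partition_on_atoms_prime_TBA:
  "partition_on (topspace W) (set_atoms (prime_TBA W))"
proof -
  let ?U = "prime_TBA W"
  have U: "?U \<subseteq> Pow (topspace W)"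
    and int: "\<And>\<S>. \<S> \<subseteq> ?U \<Longrightarrow> topspace W \<inter> \<Inter>\<S> \<in> ?U"
    and cmp: "\<And>S. S \<in> ?U \<Longrightarrow> topspace W - S \<in> ?U"
    using complete_sub_TBA_prime_TBA[of W] unfolding complete_sub_TBA_def by auto
  have int2: "A \<inter> B \<in> ?U" if "A \<in> ?U" "B \<in> ?U" for A B
  proof -
    have "topspace W \<inter> \<Inter>{A, B} = A \<inter> B"
      using that U by auto
    with int[of "{A, B}"] that show ?thesis by simp
  qed
  show ?thesis
  proof (rule partition_onI)
    show "\<Union>(set_atoms ?U) = topspace W"
    proof
      show "\<Union>(set_atoms ?U) \<subseteq> topspace W"
        using U by (auto simp: set_atoms_def)
      show "topspace W \<subseteq> \<Union>(set_atoms ?U)"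
      proof
        fix x assume x: "x \<in> topspace W"
        define A where "A = topspace W \<inter> \<Inter>{S \<in> ?U. x \<in> S}"
        have A: "A \<in> ?U" "x \<in> A"
          using int[of "{S \<in> ?U. x \<in> S}"] x by (auto simp: A_def)
        have "B = {} \<or> B = A" if B: "B \<in> ?U" "B \<subseteq> A" for B
        proof (cases "x \<in> B")
          case True
          then show ?thesis using B by (auto simp: A_def)
        next
          case False
          then have "A \<subseteq> topspace W - B"
            using cmp[OF B(1)] x unfolding A_def by blast
          then show ?thesis using B by blast
        qed
        then have "A \<in> set_atoms ?U"
          using A by (auto simp: set_atoms_def)
        with A show "x \<in> \<Union>(set_atoms ?U)" by blast
      qed
    qed
    show "disjnt p q" if p: "p \<in> set_atoms ?U" and q: "q \<in> set_atoms ?U" and ne: "p \<noteq> q" for p q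
    proof -
      have "p \<inter> q \<in> ?U" using p q int2 by (simp add: set_atoms_def)
      then have "p \<inter> q = {} \<or> p \<inter> q = p" "p \<inter> q = {} \<or> p \<inter> q = q"
        using p q by (auto simp only: set_atoms_def mem_Collect_eq Int_lower1 Int_lower2)
      then show ?thesis using ne by (auto simp: disjnt_def)
    qed
  qed (simp add: set_atoms_def)
qed

lemma cring_compact_open_ideal:
  assumes W: "stone_space W" and A: "A \<in> compact_opens W"
  shows "cring (compact_open_ideal W A)"
proof -
  let ?C = "{C \<in> compact_opens W. C \<subseteq> A}"
  have sd: "C - D \<in> compact_opens W"
    if "C \<in> compact_opens W" "D \<in> compact_opens W" for C D
  proof -
    have "closedin W D"
      using that W by (simp add: compact_opens_def stone_space_def compactin_imp_closedin)
    then have "openin W (C - D)" "closedin W (topspace W - D)"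
      using that by (auto simp: compact_opens_def openin_diff)
    moreover have "C - D = C \<inter> (topspace W - D)"
      using that openin_subset by (auto simp: compact_opens_def)
    ultimately show ?thesis
      using that compact_Int_closedin by (fastforce simp: compact_opens_def)
  qed
  have un: "C \<union> D \<in> compact_opens W"
    if "C \<in> compact_opens W" "D \<in> compact_opens W" for C D
    using that by (auto simp: compact_opens_def compactin_Un)
  have it: "C \<inter> D \<in> compact_opens W"
    if "C \<in> compact_opens W" "D \<in> compact_opens W" for C D
    using sd[OF that(1) sd[OF that]] by (simp add: Diff_Diff_Int)
  have e: "{} \<in> compact_opens W" by (simp add: compact_opens_def)
  show ?thesis
  proof (rule cringI)
    show "abelian_group (compact_open_ideal W A)"
    proof (rule abelian_groupI)
      fix x assume "x \<in> carrier (compact_open_ideal W A)"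
      then show "\<exists>y\<in>carrier (compact_open_ideal W A).
          y \<oplus>\<^bsub>compact_open_ideal W A\<^esub> x = \<zero>\<^bsub>compact_open_ideal W A\<^esub>"
        by (intro bexI[of _ x]) (auto simp: compact_open_ideal_def)
    qed (auto simp: compact_open_ideal_def e un sd)
    show "Group.comm_monoid (compact_open_ideal W A)"
      by (rule comm_monoidI) (auto simp: compact_open_ideal_def it A)
  qed (auto simp: compact_open_ideal_def)
qed

end

theory Submission
  imports Defs
begin

text \<open>Two points are called inseparable if no member of the prime TBA contains just one of them. The
classes of inseparable points are the atoms, and the members of the prime TBA are the unions of
classes. The sets invariant under all homeomorphisms form a complete sub-TBA, so they include the
prime TBA, and every orbit lies in one class. Both claims therefore say the same thing: if \<open>x\<close> and
\<open>y\<close> are inseparable, some homeomorphism takes \<open>x\<close> to \<open>y\<close>. Moreover it suffices to find a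
homeomorphism between two compact open sets that takes \<open>x\<close> to \<open>y\<close>: restricted to a small
neighbourhood, it extends to a homeomorphism of the whole space that exchanges two disjoint compact
open sets and fixes everything else (\<open>homeo_on_extends_globally\<close>).

Closure of the prime TBA under derived sets makes inseparability a back-and-forth relation: if
\<open>p\<close> and \<open>q\<close> are inseparable, every neighbourhood of \<open>q\<close> is matched by a neighbourhood of \<open>p\<close> all of
whose points other than \<open>p\<close> are inseparable from points other than \<open>q\<close> of the former
(\<open>insep_local\<close>). By minimality of the prime TBA, the classes form the coarsest partition with this
property. But the property only says which classes occur near a point, not how a compact open set
is composed of pieces.

Primitivity provides the pieces. A nonempty pseudo-indecomposable set \<open>A\<close> has a point \<open>a\<close>, its tip,
such that every neighbourhood of \<open>a\<close> contains a copy of \<open>A\<close> (\<open>pseudo_indecomposable_imp_cone\<close>: the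
sets without a copy of \<open>A\<close> would otherwise cover \<open>A\<close>, and finite unions of such sets contain no copy
either). Copies meet the same classes, so the classes that meet \<open>A\<close> already occur arbitrarily close
to \<open>a\<close>; and if \<open>a\<close> is not a limit of its own class, it is the only point of its class in \<open>A\<close>. A
compact open set with such a tip is called a cone. Only the set of classes that meet it matters for a
cone: the tips of two cones that meet the same classes are inseparable (\<open>tips_insep_if_sat_eq\<close>),
and if one of the cones is partitioned into cones, so can be the other, with corresponding pieces
meeting the same classes (\<open>cone_partition_transfer\<close>). Indeed, the classes that meet the first cone
are found arbitrarily close to the tip of the second; so cones that correspond to the pieces without
the tip fit there, and what remains of the second cone still meets all of its classes.

This is the refinement condition of Vaught's back-and-forth theorem for countable Boolean algebras,
so cones that meet the same classes are homeomorphic (\<open>back_and_forth\<close>). To control the image of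
one point, the matching pieces are required in addition to agree on containing \<open>x\<close> and \<open>y\<close>
respectively. When \<open>x\<close> lies in a piece without the tip, a small neighbourhood of \<open>y\<close> is joined to
the corresponding cone or takes its place; the result is again a cone that meets the same classes
(\<open>cone_absorbing_point\<close>).\<close>

section \<open>Compact open sets and local homeomorphisms\<close>

locale stone =
  fixes W :: "'a topology"
  assumes stone: "stone_space W"
begin

lemma Hausdorff: "Hausdorff_space W"
  using stone by (simp add: stone_space_def)

lemma co_open: "K \<in> compact_opens W \<Longrightarrow> openin W K"
  by (simp add: compact_opens_def)

lemma co_compact: "K \<in> compact_opens W \<Longrightarrow> compactin W K"
  by (simp add: compact_opens_def)

lemma co_closed: "K \<in> compact_opens W \<Longrightarrow> closedin W K"
  using Hausdorff by (simp add: compact_opens_def compactin_imp_closedin)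

lemma co_subset: "K \<in> compact_opens W \<Longrightarrow> K \<subseteq> topspace W"
  by (simp add: co_open openin_subset)

lemma co_empty: "{} \<in> compact_opens W"
  by (simp add: compact_opens_def)

lemma co_Un: "K \<in> compact_opens W \<Longrightarrow> L \<in> compact_opens W \<Longrightarrow> K \<union> L \<in> compact_opens W"
  by (simp add: compact_opens_def compactin_Un openin_Un)

lemma co_Diff:
  assumes "K \<in> compact_opens W" "L \<in> compact_opens W"
  shows "K - L \<in> compact_opens W"
proof -
  have "openin W (K - L)"
    using assms co_open co_closed by (simp add: openin_diff)
  moreover have "K - L = K \<inter> (topspace W - L)"
    using assms co_subset by blast
  moreover have "closedin W (topspace W - L)"
    using assms co_open by blast
  ultimately show ?thesis
    using assms compact_Int_closedin by (fastforce simp: compact_opens_def)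
qed

lemma co_Int: "K \<in> compact_opens W \<Longrightarrow> L \<in> compact_opens W \<Longrightarrow> K \<inter> L \<in> compact_opens W"
  using co_Diff[of K "K - L"] co_Diff[of K L] by (simp add: Diff_Diff_Int)

lemma co_Union: "finite \<F> \<Longrightarrow> \<F> \<subseteq> compact_opens W \<Longrightarrow> \<Union>\<F> \<in> compact_opens W"
  by (induction \<F> rule: finite_induct) (auto simp: co_empty co_Un)

lemma co_base:
  assumes "openin W U" "p \<in> U"
  shows "\<exists>K. K \<in> compact_opens W \<and> p \<in> K \<and> K \<subseteq> U"
proof -
  obtain \<K> where "\<K> \<subseteq> compact_opens W" "\<Union>\<K> = U"
    using stone assms(1) unfolding stone_space_def by blast
  then show ?thesis using assms(2) by blast
qed

lemma openin_delete: "openin W U \<Longrightarrow> openin W (U - {p})"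
  using Hausdorff by (metis Diff_empty Diff_insert0 closedin_Hausdorff_singleton
      insert_Diff openin_diff openin_subset subsetD)

text \<open>For open \<open>A\<close> and \<open>B\<close> this says that \<open>f\<close> restricts to a homeomorphism of the subspaces \<open>A\<close> and \<open>B\<close>.
Speaking of open sets of the whole space instead makes restriction and composition immediate.\<close>
definition homeo_on :: "('a \<Rightarrow> 'a) \<Rightarrow> 'a set \<Rightarrow> 'a set \<Rightarrow> bool"
  where "homeo_on f A B \<longleftrightarrow> bij_betw f A B \<and> (\<forall>U\<subseteq>A. openin W (f ` U) \<longleftrightarrow> openin W U)"

lemma homeo_on_id: "homeo_on id A A"
  by (simp add: homeo_on_def)

lemma homeo_on_comp:
  assumes "homeo_on f A B" "homeo_on g B C"
  shows "homeo_on (g \<circ> f) A C"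
  unfolding homeo_on_def
proof (intro conjI allI impI)
  show "bij_betw (g \<circ> f) A C"
    using assms bij_betw_trans[of f A B g C] by (simp add: homeo_on_def)
  fix U assume "U \<subseteq> A"
  then have "f ` U \<subseteq> B"
    using assms(1) by (auto simp: homeo_on_def bij_betw_def)
  then show "openin W ((g \<circ> f) ` U) = openin W U"
    using assms \<open>U \<subseteq> A\<close> by (simp add: homeo_on_def flip: image_image)
qed

lemma homeo_on_inv:
  assumes "homeo_on f A B"
  shows "homeo_on (inv_into A f) B A"
  unfolding homeo_on_def
proof (intro conjI allI impI)
  show "bij_betw (inv_into A f) B A"
    using assms bij_betw_inv_into[of f A B] by (simp add: homeo_on_def)
  fix U assume U: "U \<subseteq> B"
  have fA: "f ` A = B"
    using assms by (simp add: homeo_on_def bij_betw_def)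
  have "f ` inv_into A f ` U = U"
    using image_inv_into_cancel[OF fA U] .
  moreover have "inv_into A f ` U \<subseteq> A"
    using U inv_into_into[of _ f A] unfolding fA[symmetric] by blast
  ultimately show "openin W (inv_into A f ` U) = openin W U"
    using assms unfolding homeo_on_def by (metis (full_types))
qed

lemma homeo_on_restrict:
  assumes "homeo_on f A B" "C \<subseteq> A"
  shows "homeo_on f C (f ` C)"
  using assms unfolding homeo_on_def bij_betw_def by (auto intro: inj_on_subset)

text \<open>The form of Stone duality behind all homeomorphisms constructed below. A correspondence \<open>H\<close> between
bases of \<open>A\<close> and \<open>B\<close> comes from a homeomorphism as soon as every point on either side has a partner
on the other that lies in exactly the corresponding sets; the bases separate points, so partners are
unique, and corresponding sets are images of each other, so open sets correspond.\<close>
lemma homeo_from_pairs: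
  assumes A: "openin W A" and B: "openin W B"
    and H: "\<And>P Q. (P, Q) \<in> H \<Longrightarrow> openin W P \<and> openin W Q \<and> P \<subseteq> A \<and> Q \<subseteq> B"
    and baseA: "\<And>p U. \<lbrakk>openin W U; p \<in> U; U \<subseteq> A\<rbrakk> \<Longrightarrow> \<exists>P Q. (P, Q) \<in> H \<and> p \<in> P \<and> P \<subseteq> U"
    and baseB: "\<And>q U. \<lbrakk>openin W U; q \<in> U; U \<subseteq> B\<rbrakk> \<Longrightarrow> \<exists>P Q. (P, Q) \<in> H \<and> q \<in> Q \<and> Q \<subseteq> U"
    and partner_right: "\<And>p. p \<in> A \<Longrightarrow> \<exists>q\<in>B. \<forall>P Q. (P, Q) \<in> H \<longrightarrow> (p \<in> P \<longleftrightarrow> q \<in> Q)"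
    and partner_left: "\<And>q. q \<in> B \<Longrightarrow> \<exists>p\<in>A. \<forall>P Q. (P, Q) \<in> H \<longrightarrow> (p \<in> P \<longleftrightarrow> q \<in> Q)"
  obtains f where "homeo_on f A B" "\<forall>P Q. (P, Q) \<in> H \<longrightarrow> f ` P = Q"
proof -
  have "\<forall>p\<in>A. \<exists>q. q \<in> B \<and> (\<forall>P Q. (P, Q) \<in> H \<longrightarrow> (p \<in> P \<longleftrightarrow> q \<in> Q))"
    using partner_right by blast
  from bchoice[OF this] obtain f where f: "\<And>p. p \<in> A \<Longrightarrow> f p \<in> B"
      "\<And>p P Q. \<lbrakk>p \<in> A; (P, Q) \<in> H\<rbrakk> \<Longrightarrow> p \<in> P \<longleftrightarrow> f p \<in> Q"
    by blast
  have sepA: "p = p'" if "p \<in> A" "p' \<in> A" "\<And>P Q. (P, Q) \<in> H \<Longrightarrow> p \<in> P \<longleftrightarrow> p' \<in> P" for p p'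
    using baseA[of "A - {p'}" p] that openin_delete[OF A] by fastforce
  have sepB: "q = q'" if "q \<in> B" "q' \<in> B" "\<And>P Q. (P, Q) \<in> H \<Longrightarrow> q \<in> Q \<longleftrightarrow> q' \<in> Q" for q q'
    using baseB[of "B - {q'}" q] that openin_delete[OF B] by fastforce
  have inj: "inj_on f A"
  proof (rule inj_onI)
    fix p p' assume "p \<in> A" "p' \<in> A" "f p = f p'"
    then show "p = p'" using f(2)[of p] f(2)[of p'] by (intro sepA) auto
  qed
  have surj: "\<exists>p\<in>A. f p = q \<and> (\<forall>P Q. (P, Q) \<in> H \<longrightarrow> (p \<in> P \<longleftrightarrow> q \<in> Q))" if q: "q \<in> B" for q
  proof -
    obtain p where p: "p \<in> A" "\<forall>P Q. (P, Q) \<in> H \<longrightarrow> (p \<in> P \<longleftrightarrow> q \<in> Q)"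
      using partner_left[OF q] by blast
    have "f p = q"
      using p f q by (intro sepB) auto
    then show ?thesis using p by blast
  qed
  have img: "f ` P = Q" if PQ: "(P, Q) \<in> H" for P Q
  proof
    show "f ` P \<subseteq> Q" using f(2) PQ H[OF PQ] by blast
    show "Q \<subseteq> f ` P"
    proof
      fix q assume "q \<in> Q"
      then obtain p where "p \<in> A" "f p = q" "p \<in> P"
        using surj[of q] PQ H[OF PQ] by blast
      then show "q \<in> f ` P" by blast
    qed
  qed
  have fA: "f ` A = B"
  proof
    show "f ` A \<subseteq> B" using f(1) by blast
    show "B \<subseteq> f ` A"
    proof
      fix q assume "q \<in> B"
      from surj[OF this] show "q \<in> f ` A" by blast
    qed
  qed
  have "openin W (f ` U) \<longleftrightarrow> openin W U" if U: "U \<subseteq> A" for U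
  proof
    assume o: "openin W U"
    show "openin W (f ` U)"
    proof (rule openin_subopen[THEN iffD2], rule ballI)
      fix q assume "q \<in> f ` U"
      then obtain p where p: "p \<in> U" "q = f p" by blast
      then obtain P Q where "(P, Q) \<in> H" "p \<in> P" "P \<subseteq> U"
        using baseA[OF o _ U] by blast
      then show "\<exists>T. openin W T \<and> q \<in> T \<and> T \<subseteq> f ` U"
        using img H p by (metis image_eqI image_mono)
    qed
  next
    assume o: "openin W (f ` U)"
    show "openin W U"
    proof (rule openin_subopen[THEN iffD2], rule ballI)
      fix p assume p: "p \<in> U"
      then obtain P Q where PQ: "(P, Q) \<in> H" "f p \<in> Q" "Q \<subseteq> f ` U"
        using baseB[OF o, of "f p"] U fA by blast
      have "P \<subseteq> U"
      proof
        fix z assume z: "z \<in> P"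
        then obtain u where "u \<in> U" "f z = f u" using img[OF PQ(1)] PQ(3) by blast
        moreover have "z \<in> A" using z H[OF PQ(1)] by blast
        ultimately show "z \<in> U" using inj_onD[OF inj, of z u] U by blast
      qed
      then show "\<exists>T. openin W T \<and> p \<in> T \<and> T \<subseteq> U"
        using H[OF PQ(1)] f(2)[OF _ PQ(1), of p] PQ(2) p U by (intro exI[of _ P]) auto
    qed
  qed
  then have "homeo_on f A B"
    by (simp add: homeo_on_def bij_betw_def inj fA)
  then show thesis using that[of f] img by simp
qed

lemma directed_compact_Inter:
  assumes "\<D> \<noteq> {}" and D: "\<And>K. K \<in> \<D> \<Longrightarrow> K \<in> compact_opens W \<and> K \<noteq> {}"
    and dir: "\<And>K L. K \<in> \<D> \<Longrightarrow> L \<in> \<D> \<Longrightarrow> \<exists>M\<in>\<D>. M \<subseteq> K \<inter> L"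
  shows "\<Inter>\<D> \<noteq> {}"
proof -
  obtain K where K: "K \<in> \<D>" using assms by blast
  have lower: "\<exists>M\<in>\<D>. M \<subseteq> K \<inter> \<Inter>\<F>" if "finite \<F>" "\<F> \<subseteq> \<D>" for \<F>
    using that
  proof (induction \<F> rule: finite_induct)
    case empty then show ?case using K by auto
  next
    case (insert L \<F>)
    then obtain M where "M \<in> \<D>" "M \<subseteq> K \<inter> \<Inter>\<F>" by auto
    moreover obtain N where "N \<in> \<D>" "N \<subseteq> L \<inter> M"
      using dir[of L M] insert.prems \<open>M \<in> \<D>\<close> by auto
    ultimately have "N \<in> \<D>" "N \<subseteq> K \<inter> \<Inter>(insert L \<F>)" by auto
    then show ?case by blast
  qed
  have "\<forall>C\<in>\<D>. closedin W C" by (simp add: D co_closed)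
  moreover have "\<forall>\<F>. finite \<F> \<and> \<F> \<subseteq> \<D> \<longrightarrow> K \<inter> \<Inter>\<F> \<noteq> {}"
  proof (intro allI impI)
    fix \<F> assume "finite \<F> \<and> \<F> \<subseteq> \<D>"
    then obtain M where "M \<in> \<D>" "M \<subseteq> K \<inter> \<Inter>\<F>" using lower by blast
    then show "K \<inter> \<Inter>\<F> \<noteq> {}" using D by blast
  qed
  moreover have "compactin W K" using D K co_compact by blast
  ultimately have "K \<inter> \<Inter>\<D> \<noteq> {}"
    unfolding compactin_fip by blast
  then show ?thesis by blast
qed

text \<open>A ring isomorphism preserves intersections and relative complements. Taking its graph as the
correspondence, the partner of \<open>p\<close> is a point common to the images of all sets that contain \<open>p\<close>,
which exists by compactness; taking complements shows that it lies in no other image.\<close>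
lemma ring_iso_imp_homeo:
  assumes A: "A \<in> compact_opens W" and B: "B \<in> compact_opens W"
    and iso: "compact_open_ideal W A \<simeq> compact_open_ideal W B"
  shows "\<exists>f. homeo_on f A B"
proof -
  let ?CA = "{C \<in> compact_opens W. C \<subseteq> A}" and ?CB = "{C \<in> compact_opens W. C \<subseteq> B}"
  obtain \<phi> where \<phi>: "\<phi> \<in> ring_iso (compact_open_ideal W A) (compact_open_ideal W B)"
    using iso by (auto simp: is_ring_iso_def)
  then have bij: "bij_betw \<phi> ?CA ?CB"
    and int: "\<And>C D. C \<in> ?CA \<Longrightarrow> D \<in> ?CA \<Longrightarrow> \<phi> (C \<inter> D) = \<phi> C \<inter> \<phi> D"
    and sd: "\<And>C D. C \<in> ?CA \<Longrightarrow> D \<in> ?CA \<Longrightarrow> \<phi> (sym_diff C D) = sym_diff (\<phi> C) (\<phi> D)"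
    and one: "\<phi> A = B"
    by (auto simp: ring_iso_def ring_hom_def compact_open_ideal_def)
  have e: "\<phi> {} = {}" using sd[of "{}" "{}"] co_empty by simp
  have ne: "C = {}" if "C \<in> ?CA" "\<phi> C = {}" for C
    using inj_onD[OF bij_betw_imp_inj_on[OF bij], of C "{}"] that e co_empty by simp
  have AA: "A \<in> ?CA" using A by simp
  have cmp: "\<phi> (A - C) = B - \<phi> C" "A - C \<in> ?CA" "\<phi> C \<in> ?CB" if C: "C \<in> ?CA" for C
  proof -
    show "\<phi> C \<in> ?CB" using bij C bij_betwE by blast
    moreover have "sym_diff A C = A - C" using C by blast
    ultimately show "\<phi> (A - C) = B - \<phi> C"
      using sd[OF AA C] one by auto
    show "A - C \<in> ?CA" using C A co_Diff by blast
  qed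
  have surj: "\<exists>C\<in>?CA. \<phi> C = D" if "D \<in> ?CB" for D
    using bij that unfolding bij_betw_def by (metis (no_types, lifting) imageE)
  define H where "H = {(C, \<phi> C) | C. C \<in> ?CA}"
  show ?thesis
  proof (rule homeo_from_pairs[of A B H])
    show "openin W A" "openin W B" using A B co_open by auto
    show "openin W P \<and> openin W Q \<and> P \<subseteq> A \<and> Q \<subseteq> B" if "(P, Q) \<in> H" for P Q
      using that cmp(3) co_open unfolding H_def by blast
    show "\<exists>P Q. (P, Q) \<in> H \<and> p \<in> P \<and> P \<subseteq> U" if "openin W U" "p \<in> U" "U \<subseteq> A" for p U
      using co_base[OF that(1,2)] that unfolding H_def by blast
    show "\<exists>P Q. (P, Q) \<in> H \<and> q \<in> Q \<and> Q \<subseteq> U" if U: "openin W U" "q \<in> U" "U \<subseteq> B" for q U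
    proof -
      obtain D where "D \<in> ?CB" "q \<in> D" "D \<subseteq> U" using co_base[OF U(1,2)] U(3) by blast
      then show ?thesis using surj[of D] unfolding H_def by blast
    qed
    show "\<exists>q\<in>B. \<forall>P Q. (P, Q) \<in> H \<longrightarrow> (p \<in> P \<longleftrightarrow> q \<in> Q)" if p: "p \<in> A" for p
    proof -
      let ?D = "\<phi> ` {C \<in> ?CA. p \<in> C}"
      have "\<Inter>?D \<noteq> {}"
      proof (rule directed_compact_Inter)
        show "?D \<noteq> {}" using p AA by blast
        show "K \<in> compact_opens W \<and> K \<noteq> {}" if "K \<in> ?D" for K
          using that cmp(3) ne by blast
        show "\<exists>M\<in>?D. M \<subseteq> K \<inter> L" if KL: "K \<in> ?D" "L \<in> ?D" for K L
        proof -
          obtain C D where "C \<in> ?CA" "p \<in> C" "K = \<phi> C" "D \<in> ?CA" "p \<in> D" "L = \<phi> D"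
            using KL by blast
          then have "C \<inter> D \<in> ?CA" "p \<in> C \<inter> D" "\<phi> (C \<inter> D) = K \<inter> L"
            using co_Int int by auto
          then show ?thesis by blast
        qed
      qed
      then obtain q where q: "\<And>C. C \<in> ?CA \<Longrightarrow> p \<in> C \<Longrightarrow> q \<in> \<phi> C" by blast
      have "p \<in> C \<longleftrightarrow> q \<in> \<phi> C" if C: "C \<in> ?CA" for C
        using q[OF C] q[OF cmp(2)[OF C]] cmp(1)[OF C] p by blast
      moreover have "q \<in> B" using q[OF AA p] one by simp
      ultimately show ?thesis unfolding H_def by blast
    qed
    show "\<exists>p\<in>A. \<forall>P Q. (P, Q) \<in> H \<longrightarrow> (p \<in> P \<longleftrightarrow> q \<in> Q)" if q: "q \<in> B" for q
    proof -
      let ?D = "{C \<in> ?CA. q \<in> \<phi> C}"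
      have "\<Inter>?D \<noteq> {}"
      proof (rule directed_compact_Inter)
        show "?D \<noteq> {}" using q AA one by blast
        show "K \<in> compact_opens W \<and> K \<noteq> {}" if "K \<in> ?D" for K
          using that e by blast
        show "\<exists>M\<in>?D. M \<subseteq> K \<inter> L" if KL: "K \<in> ?D" "L \<in> ?D" for K L
        proof -
          have "K \<inter> L \<in> ?D" using KL int[of K L] co_Int by auto
          then show ?thesis by blast
        qed
      qed
      then obtain p where p: "\<And>C. C \<in> ?CA \<Longrightarrow> q \<in> \<phi> C \<Longrightarrow> p \<in> C" by blast
      have "p \<in> C \<longleftrightarrow> q \<in> \<phi> C" if C: "C \<in> ?CA" for C
        using p[OF C] p[OF cmp(2)[OF C]] cmp(1)[OF C] q by blast
      moreover have "p \<in> A" using p[OF AA] one q by simp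
      ultimately show ?thesis unfolding H_def by blast
    qed
  qed (rule exI)
qed

text \<open>If \<open>f\<close> moves \<open>p\<close>, it maps a small compact open neighbourhood \<open>N\<close> of \<open>p\<close> to a set disjoint from \<open>N\<close>.
Exchanging \<open>N\<close> with its image along \<open>f\<close> and fixing all other points is continuous, because all
three parts are open, and it is its own inverse.\<close>
lemma homeo_on_extends_globally:
  assumes f: "homeo_on f A B" and A: "openin W A" and B: "openin W B" and p: "p \<in> A"
  obtains h where "homeomorphic_map W W h" "h p = f p"
proof (cases "f p = p")
  case True
  then show thesis using that[of id] by simp
next
  case False
  have fA: "f ` A = B" and inj: "inj_on f A"
    and op: "\<And>U. U \<subseteq> A \<Longrightarrow> openin W (f ` U) \<longleftrightarrow> openin W U"
    using f by (auto simp: homeo_on_def bij_betw_def)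
  have "p \<in> topspace W" "f p \<in> topspace W"
    using p fA A B openin_subset by blast+
  then obtain U V where UV: "openin W U" "openin W V" "p \<in> U" "f p \<in> V" "U \<inter> V = {}"
    using Hausdorff False unfolding Hausdorff_space_def disjnt_def by metis
  let ?N0 = "{z \<in> A. z \<in> U \<and> f z \<in> V}"
  have "f ` {z \<in> A. f z \<in> V} = B \<inter> V" using fA by blast
  then have "openin W {z \<in> A. f z \<in> V}"
    using op[of "{z \<in> A. f z \<in> V}"] B UV by (simp add: openin_Int)
  moreover have "?N0 = U \<inter> {z \<in> A. f z \<in> V}" by blast
  ultimately have "openin W ?N0" using UV by (simp add: openin_Int)
  then obtain N where N: "N \<in> compact_opens W" "p \<in> N" "N \<subseteq> ?N0"
    using co_base[of ?N0 p] p UV by blast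
  define M where "M = f ` N"
  have NA: "N \<subseteq> A" and disj: "N \<inter> M = {}"
    using N UV unfolding M_def by auto
  define g where "g = inv_into N f"
  have injN: "inj_on f N" using inj NA inj_on_subset by blast
  have gf: "g (f z) = z" if "z \<in> N" for z
    using that injN by (simp add: g_def)
  have Mo: "openin W M" using op[OF NA] N co_open by (simp add: M_def)
  define h where "h z = (if z \<in> N then f z else if z \<in> M then g z else z)" for z
  have hN: "h z = f z" "f z \<in> M" if "z \<in> N" for z
    using that by (simp_all add: h_def M_def)
  have hM: "h (f z) = z" if z: "z \<in> N" for z
  proof -
    have "f z \<notin> N" using disj z by (auto simp: M_def)
    then show ?thesis using z gf by (simp add: h_def M_def)
  qed
  have h_id: "h z = z" if "z \<notin> N" "z \<notin> M" for z
    using that by (simp add: h_def)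
  have cases: "z \<in> N \<or> (\<exists>y\<in>N. z = f y) \<or> (z \<notin> N \<and> z \<notin> M)" for z
    by (auto simp: M_def)
  have hh: "h (h z) = z" for z
    using cases[of z] hN hM h_id by metis
  have "compactin W M"
  proof (unfold compactin_def, intro conjI allI impI)
    show "M \<subseteq> topspace W" using Mo openin_subset by blast
    fix \<U> assume \<U>: "Ball \<U> (openin W) \<and> M \<subseteq> \<Union>\<U>"
    let ?pre = "\<lambda>T. {z \<in> N. f z \<in> T}"
    have "openin W (?pre T)" if "T \<in> \<U>" for T
    proof -
      have "f ` ?pre T = M \<inter> T" by (auto simp: M_def)
      then show ?thesis
        using op[of "?pre T"] NA \<U> that Mo by (auto simp: openin_Int)
    qed
    then have "Ball (?pre ` \<U>) (openin W)" by blast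
    moreover have "N \<subseteq> \<Union>(?pre ` \<U>)" using \<U> by (auto simp: M_def)
    ultimately obtain \<G> where \<G>: "finite \<G>" "\<G> \<subseteq> ?pre ` \<U>" "N \<subseteq> \<Union>\<G>"
      using co_compact[OF N(1)] unfolding compactin_def by meson
    obtain \<T> where \<T>: "\<T> \<subseteq> \<U>" "finite \<T>" "\<G> = ?pre ` \<T>"
      using finite_subset_image[OF \<G>(1,2)] by blast
    have "M \<subseteq> \<Union>\<T>" using \<G>(3) unfolding M_def \<T>(3) by blast
    with \<T> show "\<exists>\<F>. finite \<F> \<and> \<F> \<subseteq> \<U> \<and> M \<subseteq> \<Union>\<F>" by blast
  qed
  then have Mc: "closedin W M" using Hausdorff compactin_imp_closedin by blast
  have Nc: "closedin W N" and No: "openin W N" using N co_closed co_open by auto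
  have Mtop: "M \<subseteq> topspace W" "N \<subseteq> topspace W" using Mo No openin_subset by auto
  \<comment> \<open>the preimage of an open set is described separately on the three clopen parts\<close>
  have "continuous_map W W h"
    unfolding continuous_map_def
  proof (intro conjI allI impI)
    show "h \<in> topspace W \<rightarrow> topspace W"
    proof
      fix z assume "z \<in> topspace W"
      then show "h z \<in> topspace W" using cases[of z] hN hM h_id Mtop by (metis subsetD)
    qed
    fix T assume T: "openin W T"
    have "{z \<in> topspace W. h z \<in> T} = {z \<in> N. f z \<in> T} \<union> f ` (N \<inter> T) \<union> (T - N - M)"
      (is "?L = ?R")
    proof (intro equalityI subsetI)
      fix z assume z: "z \<in> ?L"
      from cases[of z] show "z \<in> ?R"
      proof (elim disjE)
        assume "z \<in> N" then show ?thesis using z hN by simp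
      next
        assume "\<exists>y\<in>N. z = f y" then show ?thesis using z hM by auto
      next
        assume "z \<notin> N \<and> z \<notin> M" then show ?thesis using z h_id by simp
      qed
    next
      fix z assume z: "z \<in> ?R"
      then consider "z \<in> N" "f z \<in> T" | y where "y \<in> N" "y \<in> T" "z = f y"
        | "z \<in> T" "z \<notin> N" "z \<notin> M" by blast
      then show "z \<in> ?L"
      proof cases
        case 1 then show ?thesis using hN Mtop by auto
      next
        case 2 then show ?thesis using hN hM Mtop by auto
      next
        case 3 then show ?thesis using h_id openin_subset[OF T] by auto
      qed
    qed
    moreover have "f ` {z \<in> N. f z \<in> T} = M \<inter> T" by (auto simp: M_def)
    then have "openin W {z \<in> N. f z \<in> T}"
      using op[of "{z \<in> N. f z \<in> T}"] NA T Mo by (auto simp: openin_Int)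
    moreover have "openin W (f ` (N \<inter> T))"
      using op[of "N \<inter> T"] NA T No by (auto simp: openin_Int)
    moreover have "openin W (T - N - M)"
      using T Nc Mc by (simp add: openin_diff)
    ultimately show "openin W {z \<in> topspace W. h z \<in> T}"
      by (simp add: openin_Un)
  qed
  then have "homeomorphic_map W W h"
    using hh by (simp add: homeomorphic_map_involution)
  then show thesis using that[of h] hN(1)[OF N(2)] by simp
qed


section \<open>Points that the prime TBA does not separate\<close>

lemma TBA_subset: "S \<in> prime_TBA W \<Longrightarrow> S \<subseteq> topspace W"
  using complete_sub_TBA_prime_TBA[of W] unfolding complete_sub_TBA_def by blast

lemma TBA_Union: "\<S> \<subseteq> prime_TBA W \<Longrightarrow> \<Union>\<S> \<in> prime_TBA W"
  using complete_sub_TBA_prime_TBA[of W] unfolding complete_sub_TBA_def by simp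

lemma TBA_Inter: "\<S> \<subseteq> prime_TBA W \<Longrightarrow> topspace W \<inter> \<Inter>\<S> \<in> prime_TBA W"
  using complete_sub_TBA_prime_TBA[of W] unfolding complete_sub_TBA_def by simp

lemma TBA_compl: "S \<in> prime_TBA W \<Longrightarrow> topspace W - S \<in> prime_TBA W"
  using complete_sub_TBA_prime_TBA[of W] unfolding complete_sub_TBA_def by simp

lemma TBA_derived: "S \<in> prime_TBA W \<Longrightarrow> W derived_set_of S \<in> prime_TBA W"
  using complete_sub_TBA_prime_TBA[of W] unfolding complete_sub_TBA_def by simp

definition inseparable :: "'a \<Rightarrow> 'a \<Rightarrow> bool"  (infix "\<sim>" 50)
  where "p \<sim> q \<longleftrightarrow> p \<in> topspace W \<and> q \<in> topspace W \<and> (\<forall>S\<in>prime_TBA W. p \<in> S \<longleftrightarrow> q \<in> S)"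

text \<open>The saturation of \<open>A\<close>. Two sets meet the same classes if and only if they have the same saturation,
so an equation of the form \<open>sat A = sat B\<close> stands for an equality of sets of classes throughout.\<close>
definition sat :: "'a set \<Rightarrow> 'a set"
  where "sat A = {q. \<exists>p\<in>A. p \<sim> q}"

lemma insep_refl: "p \<in> topspace W \<Longrightarrow> p \<sim> p"
  by (simp add: inseparable_def)

lemma insep_sym: "p \<sim> q \<Longrightarrow> q \<sim> p"
  by (simp add: inseparable_def)

lemma insep_trans: "p \<sim> q \<Longrightarrow> q \<sim> r \<Longrightarrow> p \<sim> r"
  by (simp add: inseparable_def)

lemma insep_topspace: "p \<sim> q \<Longrightarrow> p \<in> topspace W \<and> q \<in> topspace W"
  by (simp add: inseparable_def)

lemma insep_mem: "p \<sim> q \<Longrightarrow> S \<in> prime_TBA W \<Longrightarrow> p \<in> S \<longleftrightarrow> q \<in> S"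
  by (simp add: inseparable_def)

lemma satI: "p \<in> A \<Longrightarrow> p \<sim> q \<Longrightarrow> q \<in> sat A"
  by (auto simp: sat_def)

lemma sat_mono: "A \<subseteq> B \<Longrightarrow> sat A \<subseteq> sat B"
  by (auto simp: sat_def)

lemma subset_sat: "A \<subseteq> topspace W \<Longrightarrow> A \<subseteq> sat A"
  using insep_refl by (auto simp: sat_def)

lemma sat_subsetI: "A \<subseteq> sat B \<Longrightarrow> sat A \<subseteq> sat B"
  unfolding sat_def by (blast intro: insep_trans)

lemma sat_Un: "sat (A \<union> B) = sat A \<union> sat B"
  by (auto simp: sat_def)

lemma sat_singleton_eq: "p \<sim> q \<Longrightarrow> sat {p} = sat {q}"
  unfolding sat_def by (blast intro: insep_trans insep_sym)

lemma sat_singleton: "q \<in> sat {p} \<longleftrightarrow> p \<sim> q"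
  by (simp add: sat_def)

text \<open>By closure under complements, a point that lies in all members containing \<open>p\<close> is inseparable from
\<open>p\<close>; so the class of \<open>p\<close> is an intersection of members.\<close>
lemma sat_singleton_in_TBA: "sat {p} \<in> prime_TBA W"
proof (cases "p \<in> topspace W")
  case True
  let ?S = "{S \<in> prime_TBA W. p \<in> S}"
  have "sat {p} = topspace W \<inter> \<Inter>?S"
  proof (intro equalityI subsetI)
    fix q assume "q \<in> sat {p}"
    then show "q \<in> topspace W \<inter> \<Inter>?S"
      by (auto simp: sat_singleton inseparable_def)
  next
    fix q assume q: "q \<in> topspace W \<inter> \<Inter>?S"
    have "p \<in> S \<longleftrightarrow> q \<in> S" if S: "S \<in> prime_TBA W" for S
    proof (cases "p \<in> S")
      case False
      then have "topspace W - S \<in> ?S" using TBA_compl[OF S] True by simp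
      then have "q \<in> topspace W - S" using q by blast
      then show ?thesis using False by blast
    next
      case True
      then show ?thesis using q S by blast
    qed
    then show "q \<in> sat {p}"
      using q True by (simp add: sat_singleton inseparable_def)
  qed
  moreover have "topspace W \<inter> \<Inter>?S \<in> prime_TBA W"
    by (rule TBA_Inter) blast
  ultimately show ?thesis by simp
next
  case False
  then have "sat {p} = \<Union>{}" by (auto simp: sat_def inseparable_def)
  then show ?thesis using TBA_Union[of "{}"] by simp
qed

lemma sat_in_TBA: "sat A \<in> prime_TBA W"
proof -
  have "sat A = \<Union>((\<lambda>p. sat {p}) ` A)" by (auto simp: sat_def)
  then show ?thesis using TBA_Union[of "(\<lambda>p. sat {p}) ` A"] sat_singleton_in_TBA by auto
qed

text \<open>The points that are inseparable from no point of \<open>V\<close> other than \<open>q\<close> form a member of the prime TBA,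
and \<open>q\<close> is not a limit point of it. As the derived set is again a member, neither is \<open>p\<close>.\<close>
lemma insep_local:
  assumes pq: "p \<sim> q" and V: "openin W V" "q \<in> V"
  shows "\<exists>N. openin W N \<and> p \<in> N \<and> N - {p} \<subseteq> sat (V - {q})"
proof -
  let ?S = "topspace W - sat (V - {q})"
  have "z \<notin> ?S" if "z \<in> V" "z \<noteq> q" for z
    using that insep_refl[of z] openin_subset[OF V(1)] by (auto intro: satI)
  then have "q \<notin> W derived_set_of ?S"
    using V unfolding derived_set_of_def by auto
  then have "p \<notin> W derived_set_of ?S"
    using insep_mem[OF pq TBA_derived[OF TBA_compl[OF sat_in_TBA]]] by simp
  then obtain N where N: "openin W N" "p \<in> N" "\<And>z. z \<in> N \<Longrightarrow> z \<noteq> p \<Longrightarrow> z \<notin> ?S"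
    using insep_topspace[OF pq] unfolding derived_set_of_def by blast
  then have "N - {p} \<subseteq> sat (V - {q})"
    using openin_subset[OF N(1)] by blast
  then show ?thesis using N by blast
qed

lemma prime_TBA_subset_invariant: "prime_TBA W \<subseteq> homeo_invariant_sets W"
proof (rule prime_TBA_least, unfold complete_sub_TBA_def, intro conjI allI impI ballI)
  let ?I = "homeo_invariant_sets W"
  show "?I \<subseteq> Pow (topspace W)" by (auto simp: homeo_invariant_sets_def)
  have I: "S \<in> ?I \<longleftrightarrow> S \<subseteq> topspace W \<and> (\<forall>f. homeomorphic_map W W f \<longrightarrow> f ` S = S)" for S
    by (simp add: homeo_invariant_sets_def)
  have homeo: "inj_on f (topspace W)" "f ` topspace W = topspace W"
    if "homeomorphic_map W W f" for f
    using that homeomorphic_imp_injective_map homeomorphic_imp_surjective_map by blast+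
  fix \<S> assume \<S>: "\<S> \<subseteq> ?I"
  have "\<Union>\<S> \<subseteq> topspace W" using \<S> I by blast
  moreover have "f ` \<Union>\<S> = \<Union>\<S>" if "homeomorphic_map W W f" for f
  proof -
    have "f ` S = S" if "S \<in> \<S>" for S using that \<S> I[of S] \<open>homeomorphic_map W W f\<close> by blast
    then have "(\<Union>S\<in>\<S>. f ` S) = (\<Union>S\<in>\<S>. S)" by (intro SUP_cong) auto
    then show ?thesis by (simp add: image_Union)
  qed
  ultimately show "\<Union>\<S> \<in> ?I" by (simp add: I)
  have "f ` (topspace W \<inter> \<Inter>\<S>) = topspace W \<inter> \<Inter>\<S>" if f: "homeomorphic_map W W f" for f
  proof (intro equalityI subsetI)
    fix y assume "y \<in> f ` (topspace W \<inter> \<Inter>\<S>)"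
    then obtain x where x: "x \<in> topspace W" "\<And>S. S \<in> \<S> \<Longrightarrow> x \<in> S" "y = f x" by blast
    have "f x \<in> S" if S: "S \<in> \<S>" for S
    proof -
      have "f ` S = S" using S \<S> f I[of S] by blast
      then show ?thesis using x(2)[OF S] by blast
    qed
    then show "y \<in> topspace W \<inter> \<Inter>\<S>" using x homeo(2)[OF f] by blast
  next
    fix y assume y: "y \<in> topspace W \<inter> \<Inter>\<S>"
    then obtain x where x: "x \<in> topspace W" "y = f x" using homeo(2)[OF f] by blast
    have "x \<in> S" if S: "S \<in> \<S>" for S
    proof -
      have fS: "f ` S = S" "S \<subseteq> topspace W" using S \<S> f I[of S] by blast+
      have "y \<in> f ` S" using y S fS(1) by simp
      then obtain x' where x': "x' \<in> S" "f x' = y" by auto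
      then have "x = x'" using inj_onD[OF homeo(1)[OF f], of x x'] x fS(2) by auto
      then show ?thesis using x'(1) by simp
    qed
    then show "y \<in> f ` (topspace W \<inter> \<Inter>\<S>)" using x by blast
  qed
  then show "topspace W \<inter> \<Inter>\<S> \<in> ?I" by (simp add: I)
next
  fix S assume S: "S \<in> homeo_invariant_sets W"
  then have Ssub: "S \<subseteq> topspace W" by (simp add: homeo_invariant_sets_def)
  have "f ` (topspace W - S) = topspace W - S" if "homeomorphic_map W W f" for f
    using inj_on_image_set_diff[of f "topspace W" "topspace W" S] that S Ssub
      homeomorphic_imp_injective_map[OF that] homeomorphic_imp_surjective_map[OF that]
    by (simp add: homeo_invariant_sets_def)
  then show "topspace W - S \<in> homeo_invariant_sets W" by (simp add: homeo_invariant_sets_def)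
  have "f ` (W derived_set_of S) = W derived_set_of S" if "homeomorphic_map W W f" for f
    using homeomorphic_map_derived_set_of[OF that Ssub] that S
    by (simp add: homeo_invariant_sets_def)
  then show "W derived_set_of S \<in> homeo_invariant_sets W"
    by (simp add: homeo_invariant_sets_def derived_set_of_subset_topspace)
qed

lemma homeomorphic_map_insep:
  assumes f: "homeomorphic_map W W f" and p: "p \<in> topspace W"
  shows "p \<sim> f p"
proof -
  have inj: "inj_on f (topspace W)" and im: "f ` topspace W = topspace W"
    using f homeomorphic_imp_injective_map homeomorphic_imp_surjective_map by blast+
  have "p \<in> S \<longleftrightarrow> f p \<in> S" if S: "S \<in> prime_TBA W" for S
  proof -
    have "S \<in> homeo_invariant_sets W" using S prime_TBA_subset_invariant by blast
    then have "f ` S = S" using f by (simp add: homeo_invariant_sets_def)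
    then show ?thesis
      using inj_on_image_mem_iff[OF inj p TBA_subset[OF S]] by simp
  qed
  then show ?thesis using p im by (auto simp: inseparable_def)
qed

text \<open>Homeomorphisms between open pieces preserve classes, since they agree at any given point with a
homeomorphism of the whole space. In particular, homeomorphic open sets meet the same classes.\<close>
lemma homeo_on_insep:
  assumes "homeo_on f A B" "openin W A" "openin W B" "p \<in> A"
  shows "p \<sim> f p"
proof -
  obtain h where "homeomorphic_map W W h" "h p = f p"
    using homeo_on_extends_globally[OF assms] .
  then show ?thesis
    using homeomorphic_map_insep[of h p] assms(2,4) openin_subset[of W A] by auto
qed

section \<open>Tips and cones\<close>

text \<open>All classes that meet \<open>A\<close> are to be found in every neighbourhood of \<open>a\<close>. The last condition
excludes unions of several copies of a cone: if the class of \<open>a\<close> does not accumulate at \<open>a\<close>, the number of its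
points in \<open>A\<close> is a topological invariant of \<open>A\<close>, and it has to be one.\<close>
definition tip :: "'a \<Rightarrow> 'a set \<Rightarrow> bool"
  where "tip a A \<longleftrightarrow> a \<in> A \<and> (\<forall>N. openin W N \<longrightarrow> a \<in> N \<longrightarrow> A \<subseteq> sat (A \<inter> N)) \<and>
    (a \<notin> W derived_set_of sat {a} \<longrightarrow> A \<inter> sat {a} \<subseteq> {a})"

definition cone :: "'a set \<Rightarrow> bool"
  where "cone A \<longleftrightarrow> A \<in> compact_opens W \<and> (\<exists>a. tip a A)"

lemma tip_mem: "tip a A \<Longrightarrow> a \<in> A"
  by (simp add: tip_def)

lemma tip_nbhd: "tip a A \<Longrightarrow> openin W N \<Longrightarrow> a \<in> N \<Longrightarrow> A \<subseteq> sat (A \<inter> N)"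
  by (simp add: tip_def)

lemma tip_isolated: "tip a A \<Longrightarrow> a \<notin> W derived_set_of sat {a} \<Longrightarrow> z \<in> A \<Longrightarrow> a \<sim> z \<Longrightarrow> z = a"
  by (auto simp: tip_def sat_singleton)

lemma tipI:
  assumes "a \<in> A" "\<And>N. openin W N \<Longrightarrow> a \<in> N \<Longrightarrow> A \<subseteq> sat (A \<inter> N)"
    and "\<And>z. a \<notin> W derived_set_of sat {a} \<Longrightarrow> z \<in> A \<Longrightarrow> a \<sim> z \<Longrightarrow> z = a"
  shows "tip a A"
  using assms by (auto simp: tip_def sat_singleton)

lemma insep_accumulates:
  assumes "p \<sim> q"
  shows "p \<in> W derived_set_of sat {p} \<longleftrightarrow> q \<in> W derived_set_of sat {q}"
  using insep_mem[OF assms TBA_derived[OF sat_in_TBA]] sat_singleton_eq[OF assms] by metis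

lemma tip_shrink:
  assumes a: "tip a A" and B: "openin W B" "B \<subseteq> A" "a \<in> B"
  shows "tip a B" "sat B = sat A"
proof -
  have AB: "A \<subseteq> sat (B \<inter> N)" if N: "openin W N" "a \<in> N" for N
    using tip_nbhd[OF a, of "B \<inter> N"] N B by (simp add: openin_Int Int_absorb1 le_infI1)
  show "tip a B"
  proof (rule tipI)
    show "B \<subseteq> sat (B \<inter> N)" if "openin W N" "a \<in> N" for N
      using AB[OF that] B(2) by blast
    show "z = a" if "a \<notin> W derived_set_of sat {a}" "z \<in> B" "a \<sim> z" for z
      using tip_isolated[OF a that(1) _ that(3)] that(2) B(2) by blast
  qed (rule B(3))
  have "A \<subseteq> sat B" using AB[OF B(1,3)] by simp
  then show "sat B = sat A"
    using sat_mono[OF B(2)] sat_subsetI by blast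
qed

text \<open>If the class of \<open>a\<close> accumulates at \<open>a\<close>, a cone has many tips; this gives the freedom to
choose a tip different from a given point.\<close>
lemma tip_insep:
  assumes a: "tip a A" and A: "openin W A" and b: "b \<in> A" "a \<sim> b"
  shows "tip b A"
proof (cases "a \<in> W derived_set_of sat {a}")
  case False
  then show ?thesis using tip_isolated[OF a False b] a by simp
next
  case True
  then have acc: "b \<in> W derived_set_of sat {b}" using insep_accumulates[OF b(2)] by simp
  have "A \<subseteq> sat (A \<inter> N)" if N: "openin W N" "b \<in> N" for N
  proof -
    obtain M where M: "openin W M" "a \<in> M" "M - {a} \<subseteq> sat (A \<inter> N - {b})"
      using insep_local[OF b(2), of "A \<inter> N"] N A b(1) by (auto simp: openin_Int)
    have "a \<in> sat (A \<inter> N)" using N b insep_sym by (auto intro: satI)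
    moreover have "M - {a} \<subseteq> sat (A \<inter> N)"
      using M(3) sat_mono[of "A \<inter> N - {b}" "A \<inter> N"] by blast
    ultimately have "M \<subseteq> sat (A \<inter> N)" by blast
    then have "sat (A \<inter> M) \<subseteq> sat (A \<inter> N)"
      using sat_subsetI by (meson inf.coboundedI2)
    then show ?thesis using tip_nbhd[OF a M(1,2)] by blast
  qed
  then show ?thesis using b acc by (simp add: tip_def)
qed

text \<open>If \<open>a\<close> and \<open>b\<close> were in different classes, those members of the prime TBA that do not separate \<open>a\<close>
from \<open>b\<close> would form a smaller complete sub-TBA. The point is closure under derived sets. Let \<open>S\<close> be
such a member that accumulates at \<open>a\<close>. Some class contained in \<open>S\<close> meets \<open>A\<close>, and if \<open>b\<close> belongs to \<open>S\<close>,
then so does \<open>a\<close>, and the class of \<open>a\<close> is one that does not contain \<open>b\<close>. As this class meets \<open>A\<close>, it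
meets \<open>B\<close> arbitrarily close to \<open>b\<close>, at points other than \<open>b\<close>; so \<open>S\<close> accumulates at \<open>b\<close>.\<close>
lemma tips_insep_if_sat_eq:
  assumes a: "tip a A" and A: "openin W A" and b: "tip b B" and B: "openin W B"
    and eq: "sat A = sat B"
  shows "a \<sim> b"
proof (rule ccontr)
  assume nab: "\<not> a \<sim> b"
  let ?U = "prime_TBA W"
  have top: "a \<in> topspace W" "b \<in> topspace W"
    using tip_mem[OF a] tip_mem[OF b] A B openin_subset by blast+
  have limit: "b' \<in> W derived_set_of S"
    if a': "tip a' A'" and A': "openin W A'" and b': "tip b' B'" and B': "openin W B'"
      and eq': "sat A' = sat B'" and nab': "\<not> a' \<sim> b'"
      and S: "S \<in> ?U" "a' \<in> S \<longleftrightarrow> b' \<in> S" and lim: "a' \<in> W derived_set_of S"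
    for a' b' A' B' S
    unfolding in_derived_set_of
  proof (intro conjI allI impI)
    show "b' \<in> topspace W" using tip_mem[OF b'] B' openin_subset by blast
    fix N assume bN: "b' \<in> N \<and> openin W N"
    then have N: "b' \<in> N" "openin W N" by auto
    \<comment> \<open>\<open>a'\<close> itself serves if it lies in \<open>S\<close>; otherwise \<open>b' \<notin> S\<close>, and any point of \<open>S\<close> in \<open>A'\<close> will do\<close>
    have "\<exists>z\<in>A'. z \<in> S \<and> (b' \<in> S \<longrightarrow> \<not> z \<sim> b')"
    proof (cases "a' \<in> S")
      case True
      then show ?thesis using tip_mem[OF a'] nab' by blast
    next
      case False
      obtain z where "z \<in> A'" "z \<in> S"
        using lim A' tip_mem[OF a'] unfolding derived_set_of_def by blast
      then show ?thesis using False S by blast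
    qed
    then obtain z where z: "z \<in> A'" "z \<in> S" "b' \<in> S \<longrightarrow> \<not> z \<sim> b'" by blast
    have "z \<in> sat B'" using z(1) subset_sat[OF openin_subset[OF A']] eq' by blast
    then have "z \<in> sat (B' \<inter> N)"
      using sat_subsetI[OF tip_nbhd[OF b' N(2,1)]] by blast
    then obtain w where w: "w \<in> N" "w \<sim> z" by (auto simp: sat_def)
    then have "w \<in> S" using insep_mem[OF w(2) S(1)] z(2) by simp
    moreover have "w \<noteq> b'" using \<open>w \<in> S\<close> z(3) w(2) insep_sym by blast
    ultimately show "\<exists>y. y \<noteq> b' \<and> y \<in> S \<and> y \<in> N" using w by blast
  qed
  have "complete_sub_TBA W {S \<in> ?U. a \<in> S \<longleftrightarrow> b \<in> S}" (is "complete_sub_TBA W ?B")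
    unfolding complete_sub_TBA_def
  proof (intro conjI allI impI ballI)
    show "?B \<subseteq> Pow (topspace W)" using TBA_subset by blast
    fix \<S> assume \<S>: "\<S> \<subseteq> ?B"
    then have "\<S> \<subseteq> ?U" by blast
    from TBA_Union[OF this] TBA_Inter[OF this]
    show "\<Union>\<S> \<in> ?B" "topspace W \<inter> \<Inter>\<S> \<in> ?B"
      using \<S> top by auto
  next
    fix S assume S: "S \<in> ?B"
    then show "topspace W - S \<in> ?B" using TBA_compl top by simp
    have "a \<in> W derived_set_of S \<longleftrightarrow> b \<in> W derived_set_of S"
      using limit[OF a A b B eq nab, of S] limit[OF b B a A eq[symmetric], of S] nab insep_sym S
      by blast
    then show "W derived_set_of S \<in> ?B" using S TBA_derived by simp
  qed
  then have "?U \<subseteq> ?B" by (rule prime_TBA_least)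
  then show False using nab top by (auto simp: inseparable_def)
qed

text \<open>Whether a point is the tip of some cone depends only on its class, and so do the classes that meet
this cone: by
\<open>insep_local\<close>, used in both directions, the classes that occur near \<open>q\<close> are those that occur
near \<open>c\<close>. Hence every class of tips is represented by cones as small as desired at each of
its points.\<close>
lemma tip_at_insep_point:
  assumes c: "tip c C" and C: "openin W C" and q: "c \<sim> q" and V: "openin W V" "q \<in> V"
  shows "\<exists>E. E \<in> compact_opens W \<and> E \<subseteq> V \<and> tip q E \<and> sat E = sat C"
proof -
  obtain N where N: "openin W N" "q \<in> N" "N - {q} \<subseteq> sat (C - {c})"
    using insep_local[OF insep_sym[OF q] C tip_mem[OF c]] by blast
  obtain N2 where N2: "openin W N2" "q \<in> N2"
    "q \<notin> W derived_set_of sat {q} \<longrightarrow> N2 \<inter> sat {q} \<subseteq> {q}"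
  proof (cases "q \<in> W derived_set_of sat {q}")
    case True
    then show thesis using that V by blast
  next
    case False
    then obtain M where "openin W M" "q \<in> M" "\<And>z. z \<in> M \<Longrightarrow> z \<noteq> q \<Longrightarrow> z \<notin> sat {q}"
      using insep_topspace[OF q] unfolding derived_set_of_def by blast
    then show thesis using that[of M] by blast
  qed
  obtain E where E: "E \<in> compact_opens W" "q \<in> E" "E \<subseteq> V \<inter> N \<inter> N2"
    using co_base[of "V \<inter> N \<inter> N2" q] V N N2 by (auto simp: openin_Int)
  \<comment> \<open>both inclusions between the classes of \<open>E\<close> and of \<open>C\<close> come from \<open>insep_local\<close>\<close>
  have EC: "E \<subseteq> sat C"
    using E(3) N(3) satI[OF tip_mem[OF c] q] sat_mono[of "C - {c}" C] by blast
  have CE: "C \<subseteq> sat (E \<inter> M)" if M: "openin W M" "q \<in> M" for M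
  proof -
    obtain K where K: "openin W K" "c \<in> K" "K - {c} \<subseteq> sat (E \<inter> M - {q})"
      using insep_local[OF q, of "E \<inter> M"] M E(1,2) co_open by (auto simp: openin_Int)
    have "c \<in> sat (E \<inter> M)" using M E(2) insep_sym[OF q] by (auto intro: satI)
    then have "K \<subseteq> sat (E \<inter> M)"
      using K(3) sat_mono[of "E \<inter> M - {q}" "E \<inter> M"] by blast
    then have "sat (C \<inter> K) \<subseteq> sat (E \<inter> M)"
      using sat_subsetI by (meson inf.coboundedI2)
    then show ?thesis using tip_nbhd[OF c K(1,2)] by blast
  qed
  have "tip q E"
  proof (rule tipI)
    show "E \<subseteq> sat (E \<inter> M)" if M: "openin W M" "q \<in> M" for M
      using EC sat_subsetI[OF CE[OF M]] by blast
    show "z = q" if "q \<notin> W derived_set_of sat {q}" "z \<in> E" "q \<sim> z" for z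
      using N2(3) that E(3) by (auto simp: sat_singleton)
  qed (rule E(2))
  moreover have "C \<subseteq> sat E" using CE[OF co_open[OF E(1)] E(2)] by simp
  then have "sat E = sat C" using EC sat_subsetI by blast
  ultimately show ?thesis using E by blast
qed

text \<open>If the union of two sets contains a copy of \<open>A\<close>, then one of them does, because the two parts of the
copy correspond to a partition of \<open>A\<close>. By compactness there is a point \<open>a\<close> of \<open>A\<close> all of whose
neighbourhoods contain a copy of \<open>A\<close>, though the copy need not contain \<open>a\<close>. The copying
homeomorphisms preserve classes. If the class of \<open>a\<close> does not accumulate at \<open>a\<close>, choose a
neighbourhood that contains no other point of this class: it has to hold the images of all points
of the class in \<open>A\<close>, so there is only one.\<close>
lemma pseudo_indecomposable_imp_cone:
  assumes A: "pseudo_indecomposable W A" and ne: "A \<noteq> {}"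
  shows "cone A"
proof -
  have Aco: "A \<in> compact_opens W" using A by (simp add: pseudo_indecomposable_def)
  define big where "big C \<longleftrightarrow> (\<exists>M f. M \<in> compact_opens W \<and> M \<subseteq> C \<and> homeo_on f A M)" for C
  have big_split: "big C \<or> big D" if "C \<in> compact_opens W" and CD: "big (C \<union> D)" for C D
  proof -
    obtain M f where M: "M \<in> compact_opens W" "M \<subseteq> C \<union> D" and f: "homeo_on f A M"
      using CD unfolding big_def by blast
    have bij: "bij_betw f A M" and op: "\<And>U. U \<subseteq> A \<Longrightarrow> openin W (f ` U) \<longleftrightarrow> openin W U"
      using f by (auto simp: homeo_on_def)
    define B where "B = {z \<in> A. f z \<in> C}"
    have fB: "f ` B = M \<inter> C" "f ` (A - B) = M - C"
      using bij by (auto simp: B_def bij_betw_def)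
    have MC: "M \<inter> C \<in> compact_opens W" "M - C \<in> compact_opens W"
      using M that co_Int co_Diff by auto
    have "openin W B" "openin W (A - B)"
      using op[of B] op[of "A - B"] fB MC co_open by (auto simp: B_def)
    moreover have "B = A \<inter> (topspace W - (A - B))"
      using co_subset[OF Aco] by (auto simp: B_def)
    ultimately have B: "B \<in> compact_opens W"
      using Aco compact_Int_closedin by (fastforce simp: compact_opens_def)
    then consider "compact_open_ideal W B \<simeq> compact_open_ideal W A"
      | "compact_open_ideal W (A - B) \<simeq> compact_open_ideal W A"
      using A by (auto simp: pseudo_indecomposable_def B_def)
    then show ?thesis
    proof cases
      case 1
      then obtain g where g: "homeo_on g B A" using ring_iso_imp_homeo[OF B Aco] by blast
      have "homeo_on f B (M \<inter> C)" using homeo_on_restrict[OF f, of B] fB by (simp add: B_def)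
      then have "homeo_on (f \<circ> inv_into B g) A (M \<inter> C)"
        using homeo_on_comp[OF homeo_on_inv[OF g]] by blast
      then show ?thesis using MC unfolding big_def by blast
    next
      case 2
      then obtain g where g: "homeo_on g (A - B) A"
        using ring_iso_imp_homeo[OF co_Diff[OF Aco B] Aco] by blast
      have "homeo_on f (A - B) (M - C)" using homeo_on_restrict[OF f, of "A - B"] fB by simp
      then have "homeo_on (f \<circ> inv_into (A - B) g) A (M - C)"
        using homeo_on_comp[OF homeo_on_inv[OF g]] by blast
      moreover have "M - C \<subseteq> D" using M by blast
      ultimately show ?thesis using MC unfolding big_def by blast
    qed
  qed
  have big_A: "big A" using Aco homeo_on_id unfolding big_def by blast
  have big_mono: "big D" if "big C" "C \<subseteq> D" for C D
    using that unfolding big_def by blast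
  have "\<exists>a\<in>A. \<forall>N. N \<in> compact_opens W \<longrightarrow> a \<in> N \<longrightarrow> big N"
  proof (rule ccontr)
    assume contra: "\<not> ?thesis"
    let ?\<K> = "{N \<in> compact_opens W. \<not> big N}"
    have "Ball ?\<K> (openin W)" "A \<subseteq> \<Union>?\<K>"
      using contra co_open by auto
    then obtain \<F> where \<F>: "finite \<F>" "\<F> \<subseteq> ?\<K>" "A \<subseteq> \<Union>\<F>"
      using co_compact[OF Aco] unfolding compactin_def by meson
    have "\<not> big (\<Union>\<F>)"
      using \<F>(1,2)
    proof (induction \<F> rule: finite_induct)
      case empty
      have "A = {}" if "homeo_on f A {}" for f
        using that by (simp add: homeo_on_def bij_betw_def)
      then show ?case using ne unfolding big_def by auto
    next
      case (insert N \<F>)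
      then show ?case using big_split[of N "\<Union>\<F>"] by auto
    qed
    then show False using big_mono[OF big_A \<F>(3)] by blast
  qed
  then obtain a where a: "a \<in> A" "\<And>N. N \<in> compact_opens W \<Longrightarrow> a \<in> N \<Longrightarrow> big N" by blast
  have aT: "a \<in> topspace W" using a(1) co_subset[OF Aco] by blast
  have copy: "\<exists>f. inj_on f A \<and> (\<forall>z\<in>A. f z \<in> A \<inter> N \<and> z \<sim> f z)" if N: "openin W N" "a \<in> N" for N
  proof -
    obtain K where K: "K \<in> compact_opens W" "a \<in> K" "K \<subseteq> A \<inter> N"
      using co_base[of "A \<inter> N" a] N a(1) co_open[OF Aco] by (auto simp: openin_Int)
    then obtain M f where M: "M \<in> compact_opens W" "M \<subseteq> K" and f: "homeo_on f A M"
      using a(2)[of K] unfolding big_def by blast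
    have "f z \<in> A \<inter> N \<and> z \<sim> f z" if "z \<in> A" for z
      using homeo_on_insep[OF f co_open[OF Aco] co_open[OF M(1)] that] bij_betwE[of f A M] f that M K
      by (auto simp: homeo_on_def)
    moreover have "inj_on f A" using f by (simp add: homeo_on_def bij_betw_def)
    ultimately show ?thesis by blast
  qed
  have "tip a A"
  proof (rule tipI)
    show "a \<in> A" by fact
    show "A \<subseteq> sat (A \<inter> N)" if N: "openin W N" "a \<in> N" for N
    proof
      fix z assume z: "z \<in> A"
      obtain f where "\<forall>z\<in>A. f z \<in> A \<inter> N \<and> z \<sim> f z" using copy[OF N] by blast
      then show "z \<in> sat (A \<inter> N)" using z insep_sym by (blast intro: satI)
    qed
    fix z assume acc: "a \<notin> W derived_set_of sat {a}" and z: "z \<in> A" "a \<sim> z"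
    obtain N where N: "openin W N" "a \<in> N" "\<And>z. z \<in> N \<Longrightarrow> z \<in> sat {a} \<Longrightarrow> z = a"
      using acc aT unfolding in_derived_set_of by blast
    obtain f where f: "inj_on f A" "\<forall>z\<in>A. f z \<in> A \<inter> N \<and> z \<sim> f z" using copy[OF N(1,2)] by blast
    have fa: "f z = a" if z: "z \<in> A" "a \<sim> z" for z
    proof (rule N(3))
      show "f z \<in> N" using f(2) z(1) by blast
      show "f z \<in> sat {a}" using f(2) z insep_trans[OF z(2)] by (simp add: sat_singleton)
    qed
    have "f z = f a" using fa[OF z] fa[OF a(1) insep_refl[OF aT]] by simp
    then show "z = a" using inj_onD[OF f(1)] z(1) a(1) by blast
  qed
  then show ?thesis using Aco by (auto simp: cone_def)
qed


lemma not_in_derived_set_nbhd: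
  assumes "p \<notin> W derived_set_of S" "p \<in> topspace W"
  shows "\<exists>N. openin W N \<and> p \<in> N \<and> N \<inter> S \<subseteq> {p}"
  using assms unfolding in_derived_set_of by blast

lemma derived_set_witness:
  assumes "p \<in> W derived_set_of S" "openin W N" "p \<in> N"
  shows "\<exists>z. z \<noteq> p \<and> z \<in> S \<and> z \<in> N"
  using assms by (simp add: in_derived_set_of)

text \<open>Near \<open>y\<close> there is a neighbourhood \<open>D\<close> that meets only classes that meet \<open>C\<close>. If \<open>x\<close> is the tip \<open>c\<close>
of \<open>C\<close>, then \<open>D\<close> can be chosen to be a cone itself. Otherwise \<open>D\<close> can be added to any cone that meets
the same classes as \<open>C\<close>: if the class of \<open>c\<close> does not accumulate at \<open>c\<close>, then \<open>c\<close> is its only point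
in \<open>C\<close>, so it neither contains \<open>x\<close> nor accumulates at \<open>x\<close>, and the same holds for \<open>y\<close>; hence \<open>D\<close> can be
chosen disjoint from this class, and the tip of the other cone remains the only one.\<close>
lemma cone_absorbing_point:
  assumes C: "cone C" and x: "x \<in> C" "x \<sim> y" and V: "openin W V" "y \<in> V"
  shows "\<exists>D. D \<in> compact_opens W \<and> y \<in> D \<and> D \<subseteq> V \<and>
    (\<forall>E. cone E \<longrightarrow> sat E = sat C \<longrightarrow>
      (\<exists>G. (G = D \<or> G = D \<union> E) \<and> cone G \<and> sat G = sat C))"
proof -
  obtain c where c: "tip c C" and Cco: "C \<in> compact_opens W" using C by (auto simp: cone_def)
  have Co: "openin W C" using Cco by (rule co_open)
  show ?thesis
  proof (cases "x = c")
    case True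
    obtain D where D: "D \<in> compact_opens W" "D \<subseteq> V" "tip y D" "sat D = sat C"
      using tip_at_insep_point[OF c Co _ V] x(2) True by blast
    then have "cone D" "y \<in> D" using tip_mem by (auto simp: cone_def)
    then show ?thesis using D by blast
  next
    case False
    obtain N where N: "openin W N" "y \<in> N" "N - {y} \<subseteq> sat (C - {x})"
      using insep_local[OF insep_sym[OF x(2)] Co x(1)] by blast
    have "\<exists>N2. openin W N2 \<and> y \<in> N2 \<and>
        (c \<notin> W derived_set_of sat {c} \<longrightarrow> N2 \<inter> sat {c} = {})"
    proof (cases "c \<in> W derived_set_of sat {c}")
      case True
      then show ?thesis using V by blast
    next
      case acc: False
      have none: "z \<notin> sat {c}" if "z \<in> C - {c}" for z
        using tip_isolated[OF c acc, of z] that by (auto simp: sat_singleton)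
      have "x \<notin> W derived_set_of sat {c}"
      proof
        assume acc: "x \<in> W derived_set_of sat {c}"
        have "openin W (C - {c})" "x \<in> C - {c}" using openin_delete[OF Co] x False by auto
        from derived_set_witness[OF acc this] obtain z where "z \<in> sat {c}" "z \<in> C - {c}"
          by blast
        then show False using none by blast
      qed
      then have "y \<notin> W derived_set_of sat {c}"
        using insep_mem[OF x(2) TBA_derived[OF sat_in_TBA]] by simp
      moreover have "y \<notin> sat {c}"
        using insep_mem[OF x(2) sat_in_TBA] none[of x] x(1) False by simp
      ultimately show ?thesis
        using not_in_derived_set_nbhd[of y "sat {c}"] insep_topspace[OF x(2)] by blast
    qed
    then obtain N2 where N2: "openin W N2" "y \<in> N2"
        "c \<notin> W derived_set_of sat {c} \<longrightarrow> N2 \<inter> sat {c} = {}" by blast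
    have "openin W (V \<inter> N \<inter> N2)" "y \<in> V \<inter> N \<inter> N2"
      using V N N2 by (auto simp: openin_Int)
    from co_base[OF this] obtain D
      where D: "D \<in> compact_opens W" "y \<in> D" "D \<subseteq> V \<inter> N \<inter> N2" by blast
    have "y \<in> sat C" using x by (rule satI)
    moreover have "sat (C - {x}) \<subseteq> sat C" by (rule sat_mono) blast
    ultimately have DC: "D \<subseteq> sat C" using D(3) N(3) by blast
    have absorbs: "cone (D \<union> E) \<and> sat (D \<union> E) = sat C" if E: "cone E" and eq: "sat E = sat C" for E
    proof
      obtain e where e: "tip e E" and Eco: "E \<in> compact_opens W" using E by (auto simp: cone_def)
      have ce: "c \<sim> e"
        using tips_insep_if_sat_eq[OF c Co e co_open[OF Eco]] eq by simp
      have "tip e (D \<union> E)"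
      proof (rule tipI)
        show "e \<in> D \<union> E" using tip_mem[OF e] by blast
        fix M assume M: "openin W M" "e \<in> M"
        have "sat E \<subseteq> sat (E \<inter> M)" by (rule sat_subsetI[OF tip_nbhd[OF e M]])
        moreover have "sat (E \<inter> M) \<subseteq> sat ((D \<union> E) \<inter> M)" by (rule sat_mono) blast
        moreover have "E \<subseteq> sat E" by (rule subset_sat[OF co_subset[OF Eco]])
        ultimately show "D \<union> E \<subseteq> sat ((D \<union> E) \<inter> M)" using DC eq by blast
      next
        fix z assume acc: "e \<notin> W derived_set_of sat {e}" and z: "z \<in> D \<union> E" "e \<sim> z"
        have "c \<notin> W derived_set_of sat {c}" using insep_accumulates[OF ce] acc by simp
        then have "N2 \<inter> sat {c} = {}" using N2(3) by simp
        moreover have "z \<in> sat {c}" using insep_trans[OF ce z(2)] by (simp add: sat_singleton)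
        ultimately have "z \<in> E" using z(1) D(3) by blast
        then show "z = e" using tip_isolated[OF e acc _ z(2)] by simp
      qed
      then show "cone (D \<union> E)" using co_Un[OF D(1) Eco] by (auto simp: cone_def)
      show "sat (D \<union> E) = sat C" using sat_subsetI[OF DC] eq by (auto simp: sat_Un)
    qed
    show ?thesis
    proof (rule exI[of _ D], intro conjI allI impI)
      show "D \<subseteq> V" using D(3) by blast
      fix E assume "cone E" "sat E = sat C"
      then show "\<exists>G. (G = D \<or> G = D \<union> E) \<and> cone G \<and> sat G = sat C"
        using absorbs by (intro exI[of _ "D \<union> E"]) simp
    qed (use D in simp_all)
  qed
qed

text \<open>The class of \<open>c\<close> occurs near \<open>b\<close> because it meets \<open>A\<close>. If it occurred only at \<open>b\<close> itself, then \<open>a\<close>,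
\<open>b\<close> and \<open>c\<close> would be inseparable, so \<open>A\<close> would have two points in the class of its tip; then this
class accumulates at \<open>b\<close>.\<close>
lemma insep_point_near_tip:
  assumes a: "tip a A" and A: "openin W A" and b: "tip b B" and B: "openin W B"
    and eq: "sat A = sat B" and c: "c \<in> A" "c \<noteq> a" and V: "openin W V" "b \<in> V"
  shows "\<exists>q. q \<in> B \<and> q \<in> V \<and> q \<noteq> b \<and> c \<sim> q"
proof -
  have "c \<in> sat B" using subset_sat[OF openin_subset[OF A]] c(1) eq by blast
  then have "c \<in> sat (B \<inter> V)" using sat_subsetI[OF tip_nbhd[OF b V]] by blast
  then obtain q where q: "q \<in> B" "q \<in> V" "q \<sim> c" by (auto simp: sat_def)
  show ?thesis
  proof (cases "q = b")
    case False
    then show ?thesis using q insep_sym by blast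
  next
    case True
    have ab: "a \<sim> b" by (rule tips_insep_if_sat_eq[OF a A b B eq])
    have bc: "b \<sim> c" using q(3) True by simp
    then have "a \<in> W derived_set_of sat {a}"
      using tip_isolated[OF a _ c(1) insep_trans[OF ab bc]] c(2) by blast
    then have acc: "b \<in> W derived_set_of sat {b}" using insep_accumulates[OF ab] by simp
    have "openin W (B \<inter> V)" "b \<in> B \<inter> V" using B V tip_mem[OF b] by (auto simp: openin_Int)
    from derived_set_witness[OF acc this]
    obtain q' where q': "q' \<noteq> b" "q' \<in> sat {b}" "q' \<in> B \<inter> V" by blast
    then have "c \<sim> q'" using insep_trans[OF insep_sym[OF bc]] by (simp add: sat_singleton)
    then show ?thesis using q' by blast
  qed
qed

text \<open>The cones are chosen one after the other. Each omits a neighbourhood of \<open>b\<close>, which leaves room for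
the next one.\<close>
lemma cones_near_tip:
  assumes a: "tip a A" and A: "openin W A" and b: "tip b B" and B: "openin W B"
    and eq: "sat A = sat B"
    and "finite \<C>" "\<And>C. C \<in> \<C> \<Longrightarrow> cone C \<and> C \<subseteq> A \<and> a \<notin> C" and "openin W V" "b \<in> V"
  shows "\<exists>\<beta>. (\<forall>C\<in>\<C>. cone (\<beta> C) \<and> sat (\<beta> C) = sat C \<and> \<beta> C \<subseteq> B \<inter> V - {b}) \<and>
    (\<forall>C\<in>\<C>. \<forall>D\<in>\<C>. C \<noteq> D \<longrightarrow> \<beta> C \<inter> \<beta> D = {})"
  using assms(6-)
proof (induction \<C> arbitrary: V rule: finite_induct)
  case empty
  then show ?case by simp
next
  case (insert C \<C>)
  have C: "cone C" "C \<subseteq> A" "a \<notin> C" using insert.prems(1)[of C] by auto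
  then obtain c where c: "tip c C" and Co: "openin W C" by (auto simp: cone_def co_open)
  have "c \<in> A" "c \<noteq> a" using tip_mem[OF c] C by auto
  from insep_point_near_tip[OF a A b B eq this insert.prems(2,3)]
  obtain q where q: "q \<in> B" "q \<in> V" "q \<noteq> b" "c \<sim> q" by blast
  have "openin W (B \<inter> V - {b})" using B insert.prems(2) by (simp add: openin_Int openin_delete)
  moreover have "q \<in> B \<inter> V - {b}" using q by blast
  ultimately obtain E where E: "E \<in> compact_opens W" "E \<subseteq> B \<inter> V - {b}" "tip q E" "sat E = sat C"
    using tip_at_insep_point[OF c Co q(4), of "B \<inter> V - {b}"] by blast
  have "openin W (V - E)" using insert.prems(2) co_closed[OF E(1)] by (rule openin_diff)
  moreover have "b \<in> V - E" using insert.prems(3) E(2) by blast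
  ultimately have "\<exists>\<beta>. (\<forall>C\<in>\<C>. cone (\<beta> C) \<and> sat (\<beta> C) = sat C \<and> \<beta> C \<subseteq> B \<inter> (V - E) - {b}) \<and>
      (\<forall>C\<in>\<C>. \<forall>D\<in>\<C>. C \<noteq> D \<longrightarrow> \<beta> C \<inter> \<beta> D = {})"
    by (intro insert.IH) (use insert.prems(1) in blast)+
  then obtain \<beta> where
    \<beta>1: "\<forall>C\<in>\<C>. cone (\<beta> C) \<and> sat (\<beta> C) = sat C \<and> \<beta> C \<subseteq> B \<inter> (V - E) - {b}"
    and \<beta>2: "\<forall>C\<in>\<C>. \<forall>D\<in>\<C>. C \<noteq> D \<longrightarrow> \<beta> C \<inter> \<beta> D = {}"
    by (elim exE conjE)
  have coneE: "cone E" using E by (auto simp: cone_def)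
  have ne: "D \<noteq> C" if "D \<in> \<C>" for D using that insert.hyps(2) by blast
  have EB: "E \<inter> \<beta> D = {}" "\<beta> D \<subseteq> B \<inter> V - {b}" if "D \<in> \<C>" for D using \<beta>1 that by auto
  let ?g = "\<beta>(C := E)"
  have g: "?g C = E" "\<And>D. D \<in> \<C> \<Longrightarrow> ?g D = \<beta> D" using ne by auto
  show ?case
  proof (intro exI[of _ ?g] conjI ballI impI)
    fix D assume "D \<in> insert C \<C>"
    then consider "D = C" | "D \<in> \<C>" by blast
    then show "cone (?g D)" "sat (?g D) = sat D" "?g D \<subseteq> B \<inter> V - {b}"
      using coneE E \<beta>1 EB g by (cases; simp)+
  next
    fix D D' assume D: "D \<in> insert C \<C>" "D' \<in> insert C \<C>" "D \<noteq> D'"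
    then consider "D = C" "D' \<in> \<C>" | "D' = C" "D \<in> \<C>" | "D \<in> \<C>" "D' \<in> \<C>" by blast
    then show "?g D \<inter> ?g D' = {}"
    proof cases
      case 1 then show ?thesis using g EB(1)[of D'] by simp
    next
      case 2 then show ?thesis using g EB(1)[of D] by (simp add: Int_commute)
    next
      case 3 then show ?thesis using g \<beta>2 3 D(3) by simp
    qed
  qed
qed

text \<open>Let \<open>C1\<close> be the piece that contains the tip of \<open>A\<close>. For each of the other pieces
a cone that meets the same classes is chosen near a tip \<open>b\<close> of \<open>B\<close>. What remains of \<open>B\<close> is a cone
with tip \<open>b\<close>, and it meets the same classes as \<open>C1\<close>, since both meet all classes that meet \<open>A\<close>. If
\<open>x\<close> lies in a piece \<open>Cx\<close> other than \<open>C1\<close>, then \<open>y\<close> has to be in the cone chosen for \<open>Cx\<close>: a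
neighbourhood of \<open>y\<close> is set aside in advance and either joined to this cone or used in its place. For
this \<open>b\<close> has to differ from \<open>y\<close>.\<close>
lemma cone_partition_transfer:
  assumes xy: "x \<sim> y" and A: "cone A" and B: "cone B" and eq: "sat A = sat B"
    and mark: "x \<in> A \<longleftrightarrow> y \<in> B"
    and fin: "finite \<C>" and disj: "\<And>C D. C \<in> \<C> \<Longrightarrow> D \<in> \<C> \<Longrightarrow> C \<noteq> D \<Longrightarrow> C \<inter> D = {}"
    and un: "\<Union>\<C> = A" and cones: "\<And>C. C \<in> \<C> \<Longrightarrow> cone C"
  shows "\<exists>\<beta>. (\<forall>C\<in>\<C>. cone (\<beta> C) \<and> sat (\<beta> C) = sat C \<and> (x \<in> C \<longleftrightarrow> y \<in> \<beta> C)) \<and>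
    (\<forall>C\<in>\<C>. \<forall>D\<in>\<C>. C \<noteq> D \<longrightarrow> \<beta> C \<inter> \<beta> D = {}) \<and> (\<Union>C\<in>\<C>. \<beta> C) = B"
proof -
  obtain a where a: "tip a A" and Aco: "A \<in> compact_opens W" using A by (auto simp: cone_def)
  obtain b0 where b0: "tip b0 B" and Bco: "B \<in> compact_opens W" using B by (auto simp: cone_def)
  have Ao: "openin W A" and Bo: "openin W B" using Aco Bco co_open by auto
  obtain C1 where C1: "C1 \<in> \<C>" "a \<in> C1" using tip_mem[OF a] un by blast
  have C1A: "C1 \<subseteq> A" using C1(1) un by blast
  have rest: "cone C \<and> C \<subseteq> A \<and> a \<notin> C" if "C \<in> \<C> - {C1}" for C
    using that cones[of C] un disj[of C C1] C1 by auto
  have fin': "finite (\<C> - {C1})" using fin by simp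
  have near: "\<exists>\<beta>. (\<forall>C\<in>\<C> - {C1}. cone (\<beta> C) \<and> sat (\<beta> C) = sat C \<and> \<beta> C \<subseteq> B \<inter> V - {b}) \<and>
      (\<forall>C\<in>\<C> - {C1}. \<forall>D\<in>\<C> - {C1}. C \<noteq> D \<longrightarrow> \<beta> C \<inter> \<beta> D = {})"
    if b: "tip b B" and V: "openin W V" "b \<in> V" for b V
    by (rule cones_near_tip[OF a Ao b Bo eq fin' rest V])
  \<comment> \<open>the part of the new partition that corresponds to the pieces other than \<open>C1\<close>\<close>
  have "\<exists>b \<gamma>. tip b B \<and>
      (\<forall>C\<in>\<C> - {C1}. cone (\<gamma> C) \<and> sat (\<gamma> C) = sat C \<and> \<gamma> C \<subseteq> B - {b} \<and> (x \<in> C \<longleftrightarrow> y \<in> \<gamma> C)) \<and>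
      (\<forall>C\<in>\<C> - {C1}. \<forall>D\<in>\<C> - {C1}. C \<noteq> D \<longrightarrow> \<gamma> C \<inter> \<gamma> D = {})"
  proof (cases "\<exists>C\<in>\<C> - {C1}. x \<in> C")
    case False
    \<comment> \<open>none of the chosen cones contains \<open>y\<close>, either because they omit \<open>b0\<close> or by the choice of \<open>V\<close>\<close>
    let ?V = "if y = b0 then B else B - {y}"
    have "openin W ?V" "b0 \<in> ?V" using Bo openin_delete tip_mem[OF b0] by auto
    from near[OF b0 this] obtain \<gamma> where
      \<gamma>: "\<forall>C\<in>\<C> - {C1}. cone (\<gamma> C) \<and> sat (\<gamma> C) = sat C \<and> \<gamma> C \<subseteq> B \<inter> ?V - {b0}"
        "\<forall>C\<in>\<C> - {C1}. \<forall>D\<in>\<C> - {C1}. C \<noteq> D \<longrightarrow> \<gamma> C \<inter> \<gamma> D = {}" by (elim exE conjE)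
    have "cone (\<gamma> C) \<and> sat (\<gamma> C) = sat C \<and> \<gamma> C \<subseteq> B - {b0} \<and> (x \<in> C \<longleftrightarrow> y \<in> \<gamma> C)"
      if C: "C \<in> \<C> - {C1}" for C
    proof -
      have g: "cone (\<gamma> C)" "sat (\<gamma> C) = sat C" "\<gamma> C \<subseteq> B \<inter> ?V - {b0}" using \<gamma>(1) C by auto
      moreover have "y \<notin> \<gamma> C" using g(3) by (auto split: if_splits)
      moreover have "x \<notin> C" using False C by blast
      ultimately show ?thesis by blast
    qed
    then show ?thesis using b0 \<gamma>(2) by blast
  next
    case True
    then obtain Cx where Cx: "Cx \<in> \<C> - {C1}" "x \<in> Cx" by blast
    have xA: "x \<in> A" and yB: "y \<in> B" using Cx un mark by auto
    have x_ne_a: "x \<noteq> a" using rest[OF Cx(1)] Cx(2) by blast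
    \<comment> \<open>if \<open>y\<close> is a tip, then \<open>x\<close> is inseparable from the tip of \<open>A\<close>, so the class accumulates there\<close>
    have "\<exists>b. tip b B \<and> b \<noteq> y"
    proof (cases "b0 = y")
      case False then show ?thesis using b0 by blast
    next
      case True
      from insep_point_near_tip[OF a Ao b0 Bo eq xA x_ne_a Bo tip_mem[OF b0]]
      obtain q where q: "q \<in> B" "q \<noteq> b0" "x \<sim> q" by blast
      have "b0 \<sim> q" using insep_trans[OF insep_sym[OF xy] q(3)] True by simp
      then show ?thesis using tip_insep[OF b0 Bo q(1)] q(2) True by blast
    qed
    then obtain b where b: "tip b B" "b \<noteq> y" by blast
    have "cone Cx" using rest[OF Cx(1)] by simp
    moreover have "openin W (B - {b})" "y \<in> B - {b}" using openin_delete[OF Bo] yB b(2) by auto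
    ultimately obtain D where D: "D \<in> compact_opens W" "y \<in> D" "D \<subseteq> B - {b}"
      and absorb: "\<And>E. cone E \<Longrightarrow> sat E = sat Cx \<Longrightarrow>
        \<exists>G. (G = D \<or> G = D \<union> E) \<and> cone G \<and> sat G = sat Cx"
      using cone_absorbing_point[OF _ Cx(2) xy, of "B - {b}"] by blast
    have "openin W (B - D)" "b \<in> B - D"
      using openin_diff[OF Bo co_closed[OF D(1)]] tip_mem[OF b(1)] D(3) by auto
    from near[OF b(1) this] obtain \<beta> where
      \<beta>: "\<forall>C\<in>\<C> - {C1}. cone (\<beta> C) \<and> sat (\<beta> C) = sat C \<and> \<beta> C \<subseteq> B \<inter> (B - D) - {b}"
        "\<forall>C\<in>\<C> - {C1}. \<forall>D\<in>\<C> - {C1}. C \<noteq> D \<longrightarrow> \<beta> C \<inter> \<beta> D = {}" by (elim exE conjE)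
    have "cone (\<beta> Cx)" "sat (\<beta> Cx) = sat Cx" using \<beta>(1) Cx(1) by auto
    from absorb[OF this] obtain G where G: "G = D \<or> G = D \<union> \<beta> Cx" "cone G" "sat G = sat Cx" by blast
    have Gsub: "D \<subseteq> G" "G \<subseteq> D \<union> \<beta> Cx" using G(1) by auto
    have bsub: "\<beta> C \<subseteq> B - D - {b}" if "C \<in> \<C> - {C1}" for C using \<beta>(1) that by blast
    let ?g = "\<beta>(Cx := G)"
    have g: "cone (?g C) \<and> sat (?g C) = sat C \<and> ?g C \<subseteq> B - {b} \<and> (x \<in> C \<longleftrightarrow> y \<in> ?g C)"
      if C: "C \<in> \<C> - {C1}" for C
    proof (cases "C = Cx")
      case True
      have "G \<subseteq> B - {b}" using Gsub(2) D(3) bsub[OF Cx(1)] by blast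
      moreover have "y \<in> G" using Gsub(1) D(2) by blast
      ultimately show ?thesis using True G Cx(2) by simp
    next
      case False
      have "x \<notin> C" using disj[of C Cx] C Cx False by blast
      moreover have "y \<notin> \<beta> C" using bsub[OF C] D(2) by blast
      moreover have "\<beta> C \<subseteq> B - {b}" using bsub[OF C] by blast
      ultimately show ?thesis using False \<beta>(1) C by simp
    qed
    have GC: "G \<inter> \<beta> C = {}" if C: "C \<in> \<C> - {C1}" "C \<noteq> Cx" for C
    proof -
      have "\<beta> Cx \<inter> \<beta> C = {}" using \<beta>(2) Cx(1) C by blast
      then show ?thesis using Gsub(2) bsub[OF C(1)] by blast
    qed
    have g_disj: "?g C \<inter> ?g C' = {}" if C: "C \<in> \<C> - {C1}" "C' \<in> \<C> - {C1}" "C \<noteq> C'" for C C'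
    proof (cases "C = Cx")
      case True
      then show ?thesis using GC[of C'] C by simp
    next
      case False
      have "\<beta> C \<inter> \<beta> C' = {}" using \<beta>(2) C by blast
      then show ?thesis using False GC[of C] C by (cases "C' = Cx") (simp_all add: Int_commute)
    qed
    show ?thesis
      by (rule exI[of _ b], rule exI[of _ ?g], intro conjI ballI impI b(1) g_disj)
        (use g in simp_all)
  qed
  then obtain b \<gamma> where b: "tip b B"
    and \<gamma>1: "\<forall>C\<in>\<C> - {C1}.
        cone (\<gamma> C) \<and> sat (\<gamma> C) = sat C \<and> \<gamma> C \<subseteq> B - {b} \<and> (x \<in> C \<longleftrightarrow> y \<in> \<gamma> C)"
    and \<gamma>2: "\<forall>C\<in>\<C> - {C1}. \<forall>D\<in>\<C> - {C1}. C \<noteq> D \<longrightarrow> \<gamma> C \<inter> \<gamma> D = {}"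
    by (elim exE conjE)
  note \<gamma> = bspec[OF \<gamma>1]
  define B1 where "B1 = B - (\<Union>C\<in>\<C> - {C1}. \<gamma> C)"
  have "(\<Union>C\<in>\<C> - {C1}. \<gamma> C) \<in> compact_opens W"
    using \<gamma> fin' by (intro co_Union) (auto simp: cone_def)
  then have B1co: "B1 \<in> compact_opens W" using co_Diff[OF Bco] by (simp add: B1_def)
  have bB1: "b \<in> B1" using \<gamma> tip_mem[OF b] by (auto simp: B1_def)
  have B1B: "B1 \<subseteq> B" by (auto simp: B1_def)
  have B1: "tip b B1" "sat B1 = sat B" using tip_shrink[OF b co_open[OF B1co] B1B bB1] by auto
  have "sat C1 = sat A"
    using tip_shrink(2)[OF a _ C1A C1(2)] cones[OF C1(1)] co_open by (auto simp: cone_def)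
  then have satB1: "sat B1 = sat C1" using B1(2) eq by simp
  \<comment> \<open>\<open>y\<close> is in the remainder unless it was put into the cone chosen for a piece that contains \<open>x\<close>\<close>
  have markB1: "x \<in> C1 \<longleftrightarrow> y \<in> B1"
  proof
    assume x: "x \<in> C1"
    then have "y \<in> B" using mark C1A by blast
    moreover have "y \<notin> \<gamma> C" if C: "C \<in> \<C> - {C1}" for C
      using \<gamma>[OF C] disj[of C C1] C C1(1) x by blast
    ultimately show "y \<in> B1" by (auto simp: B1_def)
  next
    assume y: "y \<in> B1"
    then have "x \<in> A" using mark B1B by blast
    then obtain C where C: "C \<in> \<C>" "x \<in> C" using un by blast
    have "C = C1"
    proof (rule ccontr)
      assume "C \<noteq> C1"
      then have "C \<in> \<C> - {C1}" using C by blast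
      then have "y \<in> \<gamma> C" using \<gamma> C(2) by blast
      then show False using y \<open>C \<in> \<C> - {C1}\<close> by (auto simp: B1_def)
    qed
    then show "x \<in> C1" using C by simp
  qed
  let ?\<beta> = "\<gamma>(C1 := B1)"
  have other: "?\<beta> C = \<gamma> C" if "C \<in> \<C> - {C1}" for C using that by simp
  have B1\<gamma>: "B1 \<inter> \<gamma> C = {}" if "C \<in> \<C> - {C1}" for C using that by (auto simp: B1_def)
  show ?thesis
  proof (intro exI[of _ ?\<beta>] conjI ballI impI)
    fix C assume "C \<in> \<C>"
    then consider "C = C1" | "C \<in> \<C> - {C1}" by blast
    then have "cone (?\<beta> C) \<and> sat (?\<beta> C) = sat C \<and> (x \<in> C \<longleftrightarrow> y \<in> ?\<beta> C)"
    proof cases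
      case 1
      then show ?thesis using B1(1) B1co satB1 markB1 by (auto simp: cone_def)
    next
      case 2
      then show ?thesis using \<gamma>[OF 2] by simp
    qed
    then show "cone (?\<beta> C)" "sat (?\<beta> C) = sat C" "x \<in> C \<longleftrightarrow> y \<in> ?\<beta> C" by auto
  next
    fix C D assume CD: "C \<in> \<C>" "D \<in> \<C>" "C \<noteq> D"
    then consider "C = C1" "D \<in> \<C> - {C1}" | "D = C1" "C \<in> \<C> - {C1}"
      | "C \<in> \<C> - {C1}" "D \<in> \<C> - {C1}" by blast
    then show "?\<beta> C \<inter> ?\<beta> D = {}"
    proof cases
      case 1 then show ?thesis using B1\<gamma>[of D] by simp
    next
      case 2 then show ?thesis using B1\<gamma>[of C] by (simp add: Int_commute)
    next
      case 3 then show ?thesis using \<gamma>2 3 CD(3) by simp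
    qed
  next
    have "(\<Union>C\<in>\<C>. ?\<beta> C) = ?\<beta> C1 \<union> (\<Union>C\<in>\<C> - {C1}. ?\<beta> C)" using C1(1) by blast
    also have "(\<Union>C\<in>\<C> - {C1}. ?\<beta> C) = (\<Union>C\<in>\<C> - {C1}. \<gamma> C)" by (intro SUP_cong) auto
    also have "?\<beta> C1 \<union> (\<Union>C\<in>\<C> - {C1}. \<gamma> C) = B"
      using \<gamma> by (auto simp: B1_def)
    finally show "(\<Union>C\<in>\<C>. ?\<beta> C) = B" .
  qed
qed


section \<open>Back and forth\<close>

definition matching :: "('a set \<Rightarrow> 'a set \<Rightarrow> bool) \<Rightarrow> 'a set \<Rightarrow> 'a set \<Rightarrow> ('a set \<times> 'a set) set \<Rightarrow> bool"
  where "matching R A B F \<longleftrightarrow> finite F \<and> (\<forall>z\<in>F. R (fst z) (snd z)) \<and>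
    \<Union>(fst ` F) = A \<and> \<Union>(snd ` F) = B \<and>
    (\<forall>z\<in>F. \<forall>w\<in>F. z \<noteq> w \<longrightarrow> fst z \<inter> fst w = {} \<and> snd z \<inter> snd w = {})"

definition refines :: "('a set \<times> 'a set) set \<Rightarrow> ('a set \<times> 'a set) set \<Rightarrow> bool"
  where "refines G F \<longleftrightarrow> (\<forall>w\<in>G. \<exists>z\<in>F. fst w \<subseteq> fst z \<and> snd w \<subseteq> snd z)"

lemma matchingD:
  assumes "matching R A B F"
  shows "finite F" "z \<in> F \<Longrightarrow> R (fst z) (snd z)" "\<Union>(fst ` F) = A" "\<Union>(snd ` F) = B"
    "z \<in> F \<Longrightarrow> w \<in> F \<Longrightarrow> p \<in> fst z \<Longrightarrow> p \<in> fst w \<Longrightarrow> z = w"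
    "z \<in> F \<Longrightarrow> w \<in> F \<Longrightarrow> q \<in> snd z \<Longrightarrow> q \<in> snd w \<Longrightarrow> z = w"
  using assms unfolding matching_def by (simp_all, blast+)

lemma matchingI:
  assumes "finite F" "\<And>z. z \<in> F \<Longrightarrow> R (fst z) (snd z)" "\<Union>(fst ` F) = A" "\<Union>(snd ` F) = B"
    "\<And>z w p. z \<in> F \<Longrightarrow> w \<in> F \<Longrightarrow> p \<in> fst z \<Longrightarrow> p \<in> fst w \<Longrightarrow> z = w"
    "\<And>z w q. z \<in> F \<Longrightarrow> w \<in> F \<Longrightarrow> q \<in> snd z \<Longrightarrow> q \<in> snd w \<Longrightarrow> z = w"
  shows "matching R A B F"
proof -
  have "fst z \<inter> fst w = {} \<and> snd z \<inter> snd w = {}" if "z \<in> F" "w \<in> F" "z \<noteq> w" for z w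
    using assms(5)[OF that(1,2)] assms(6)[OF that(1,2)] that(3) by blast
  then show ?thesis using assms(1-4) by (simp add: matching_def)
qed

lemma matching_swap:
  assumes F: "matching R A B F"
  shows "matching (\<lambda>P Q. R Q P) B A (prod.swap ` F)"
proof (rule matchingI)
  note D = matchingD[OF F]
  show "finite (prod.swap ` F)" using D(1) by simp
  show "R (snd z) (fst z)" if "z \<in> prod.swap ` F" for z using that D(2) by auto
  show "\<Union>(fst ` prod.swap ` F) = B" "\<Union>(snd ` prod.swap ` F) = A"
    using D(3,4) by (simp_all add: image_image)
  fix z w p assume "z \<in> prod.swap ` F" "w \<in> prod.swap ` F"
  then obtain z' w' where *: "z' \<in> F" "w' \<in> F" "z = prod.swap z'" "w = prod.swap w'" by blast
  show "z = w" if "p \<in> fst z" "p \<in> fst w" using that * D(6)[OF *(1,2), of p] by simp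
  show "z = w" if "p \<in> snd z" "p \<in> snd w" using that * D(5)[OF *(1,2), of p] by simp
qed

lemma refines_swap: "refines G F \<Longrightarrow> refines (prod.swap ` G) (prod.swap ` F)"
  unfolding refines_def by fastforce

lemma refines_refl: "refines F F"
  unfolding refines_def by blast

lemma refines_trans:
  assumes "refines H G" "refines G F"
  shows "refines H F"
  unfolding refines_def
proof
  fix w assume "w \<in> H"
  then obtain v where v: "v \<in> G" "fst w \<subseteq> fst v" "snd w \<subseteq> snd v"
    using assms(1) unfolding refines_def by blast
  then obtain z where "z \<in> F" "fst v \<subseteq> fst z" "snd v \<subseteq> snd z"
    using assms(2) unfolding refines_def by blast
  then show "\<exists>z\<in>F. fst w \<subseteq> fst z \<and> snd w \<subseteq> snd z" using v by blast
qed

lemma matching_refine: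
  assumes F: "matching R A B F"
    and split: "\<And>P Q. R P Q \<Longrightarrow> \<exists>G. matching R P Q G \<and> (\<forall>w\<in>G. good w)"
  shows "\<exists>G. matching R A B G \<and> refines G F \<and> (\<forall>w\<in>G. good w)"
proof -
  note D = matchingD[OF F]
  have "\<forall>z\<in>F. \<exists>G. matching R (fst z) (snd z) G \<and> (\<forall>w\<in>G. good w)"
    using D(2) split by blast
  from bchoice[OF this] obtain g
    where g: "\<And>z. z \<in> F \<Longrightarrow> matching R (fst z) (snd z) (g z)"
      and good: "\<And>z w. z \<in> F \<Longrightarrow> w \<in> g z \<Longrightarrow> good w" by blast
  have sub: "fst w \<subseteq> fst z" "snd w \<subseteq> snd z" if "z \<in> F" "w \<in> g z" for z w
    using matchingD(3,4)[OF g[OF that(1)]] that(2) by blast+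
  let ?G = "\<Union>(g ` F)"
  have "matching R A B ?G"
  proof (rule matchingI)
    show "finite ?G" using D(1) matchingD(1)[OF g] by blast
    show "R (fst w) (snd w)" if "w \<in> ?G" for w using that matchingD(2)[OF g] by blast
    have "\<Union>(fst ` ?G) = (\<Union>z\<in>F. \<Union>(fst ` g z))" by blast
    also have "\<dots> = (\<Union>z\<in>F. fst z)" by (rule SUP_cong[OF refl]) (rule matchingD(3)[OF g])
    finally show "\<Union>(fst ` ?G) = A" using D(3) by simp
    have "\<Union>(snd ` ?G) = (\<Union>z\<in>F. \<Union>(snd ` g z))" by blast
    also have "\<dots> = (\<Union>z\<in>F. snd z)" by (rule SUP_cong[OF refl]) (rule matchingD(4)[OF g])
    finally show "\<Union>(snd ` ?G) = B" using D(4) by simp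
    fix v w p assume "v \<in> ?G" "w \<in> ?G"
    then obtain y z where yz: "y \<in> F" "v \<in> g y" "z \<in> F" "w \<in> g z" by blast
    show "v = w" if p: "p \<in> fst v" "p \<in> fst w"
    proof -
      have "y = z" using D(5)[OF yz(1,3), of p] p sub(1)[OF yz(1,2)] sub(1)[OF yz(3,4)] by blast
      then show ?thesis using matchingD(5)[OF g[OF yz(3)] _ yz(4) p] yz(2) by simp
    qed
    show "v = w" if p: "p \<in> snd v" "p \<in> snd w"
    proof -
      have "y = z" using D(6)[OF yz(1,3), of p] p sub(2)[OF yz(1,2)] sub(2)[OF yz(3,4)] by blast
      then show ?thesis using matchingD(6)[OF g[OF yz(3)] _ yz(4) p] yz(2) by simp
    qed
  qed
  moreover have "refines ?G F" unfolding refines_def using sub by blast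
  ultimately show ?thesis using good by blast
qed

text \<open>For every \<open>n\<close> exactly one pair of \<open>F n\<close> has \<open>p\<close> in its left piece. The right pieces of these pairs
decrease, so by compactness they have a common point, and it lies in no other right piece of the same step.\<close>
lemma matching_sequence_partner:
  assumes F: "\<And>n. matching R A B (F n)" and ref: "\<And>n. refines (F (Suc n)) (F n)"
    and R: "\<And>P Q. R P Q \<Longrightarrow> Q \<in> compact_opens W \<and> Q \<noteq> {}"
    and p: "p \<in> A"
  shows "\<exists>q\<in>B. \<forall>n. \<forall>z\<in>F n. p \<in> fst z \<longleftrightarrow> q \<in> snd z"
proof -
  have ref': "refines (F n) (F m)" if "m \<le> n" for m n
    using that by (induction n rule: dec_induct) (auto intro: refines_refl refines_trans ref)
  have cover: "\<exists>z\<in>F n. p \<in> fst z" for n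
    using matchingD(3)[OF F[of n]] p by blast
  then obtain z where z: "\<And>n. z n \<in> F n" "\<And>n. p \<in> fst (z n)" by metis
  have dec: "snd (z n) \<subseteq> snd (z m)" if mn: "m \<le> n" for m n
  proof -
    obtain w where w: "w \<in> F m" "fst (z n) \<subseteq> fst w" "snd (z n) \<subseteq> snd w"
      using ref'[OF mn] z(1) unfolding refines_def by blast
    have "w = z m" using matchingD(5)[OF F w(1) z(1)[of m], of p] w(2) z(2) by blast
    then show ?thesis using w(3) by simp
  qed
  let ?D = "range (\<lambda>n. snd (z n))"
  have "\<Inter>?D \<noteq> {}"
  proof (rule directed_compact_Inter)
    show "K \<in> compact_opens W \<and> K \<noteq> {}" if "K \<in> ?D" for K
      using that R[OF matchingD(2)[OF F z(1)]] by blast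
    fix K L assume "K \<in> ?D" "L \<in> ?D"
    then obtain m n where mn: "K = snd (z m)" "L = snd (z n)" by blast
    have "snd (z (max m n)) \<subseteq> K \<inter> L" using dec[of m "max m n"] dec[of n "max m n"] mn by auto
    then show "\<exists>M\<in>?D. M \<subseteq> K \<inter> L" by blast
  qed simp
  then obtain q where q: "\<And>n. q \<in> snd (z n)" by blast
  have "p \<in> fst w \<longleftrightarrow> q \<in> snd w" if w: "w \<in> F n" for n w
  proof
    assume "p \<in> fst w"
    then have "w = z n" using matchingD(5)[OF F w z(1)[of n]] z(2) by blast
    then show "q \<in> snd w" using q by simp
  next
    assume "q \<in> snd w"
    then have "w = z n" using matchingD(6)[OF F w z(1)[of n]] q by blast
    then show "p \<in> fst w" using z(2) by simp
  qed
  moreover have "q \<in> B" using matchingD(4)[OF F[of 0]] z(1)[of 0] q[of 0] by blast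
  ultimately show ?thesis by blast
qed

text \<open>Vaught's theorem, with control over the image of one point. Starting with the pair of \<open>A\<close> and \<open>B\<close>, the
compact open sets are enumerated and every one of them is decided by some step, on the left and on
the right; the pairs of all steps then form a correspondence between bases. The point \<open>p\<close> is sent to
\<open>q\<close> because no related pair distinguishes them.\<close>
lemma back_and_forth:
  assumes count: "countable (compact_opens W)" and AB: "R A B"
    and R: "\<And>P Q. R P Q \<Longrightarrow> P \<in> compact_opens W \<and> Q \<in> compact_opens W \<and> P \<noteq> {} \<and> Q \<noteq> {}"
    and split_left: "\<And>P Q K. \<lbrakk>R P Q; K \<in> compact_opens W\<rbrakk> \<Longrightarrow>
      \<exists>G. matching R P Q G \<and> (\<forall>w\<in>G. fst w \<subseteq> K \<or> fst w \<inter> K = {})"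
    and split_right: "\<And>P Q K. \<lbrakk>R P Q; K \<in> compact_opens W\<rbrakk> \<Longrightarrow>
      \<exists>G. matching R P Q G \<and> (\<forall>w\<in>G. snd w \<subseteq> K \<or> snd w \<inter> K = {})"
    and pq: "p \<in> A" "q \<in> B" "\<And>P Q. R P Q \<Longrightarrow> p \<in> P \<longleftrightarrow> q \<in> Q"
  shows "\<exists>f. homeo_on f A B \<and> f p = q"
proof -
  define e where "e = from_nat_into (compact_opens W)"
  have e: "e n \<in> compact_opens W" for n
    unfolding e_def by (rule from_nat_into) (use co_empty in blast)
  have e_surj: "\<exists>n. e n = K" if "K \<in> compact_opens W" for K
    using from_nat_into_surj[OF count that] by (simp add: e_def)
  define decides where "decides K w \<longleftrightarrow>
    (fst w \<subseteq> K \<or> fst w \<inter> K = {}) \<and> (snd w \<subseteq> K \<or> snd w \<inter> K = {})" for K and w :: "'a set \<times> 'a set"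
  have step: "\<exists>G. matching R A B G \<and> refines G F \<and> (\<forall>w\<in>G. decides (e n) w)"
    if F: "matching R A B F" for F n
  proof -
    obtain G1 where G1: "matching R A B G1" "refines G1 F"
        "\<forall>w\<in>G1. fst w \<subseteq> e n \<or> fst w \<inter> e n = {}"
      using matching_refine[where good = "\<lambda>w. fst w \<subseteq> e n \<or> fst w \<inter> e n = {}", OF F split_left[OF _ e]]
      by blast
    obtain G2 where G2: "matching R A B G2" "refines G2 G1"
        "\<forall>w\<in>G2. snd w \<subseteq> e n \<or> snd w \<inter> e n = {}"
      using matching_refine[where good = "\<lambda>w. snd w \<subseteq> e n \<or> snd w \<inter> e n = {}", OF G1(1) split_right[OF _ e]]
      by blast
    have "decides (e n) w" if w: "w \<in> G2" for w
    proof -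
      obtain v where "v \<in> G1" "fst w \<subseteq> fst v" using G2(2) w unfolding refines_def by blast
      then have "fst w \<subseteq> e n \<or> fst w \<inter> e n = {}" using G1(3) by blast
      then show ?thesis using G2(3) w by (simp add: decides_def)
    qed
    then show ?thesis using G2(1) refines_trans[OF G2(2) G1(2)] by blast
  qed
  have "\<exists>F. \<forall>n. matching R A B (F n) \<and>
      (refines (F (Suc n)) (F n) \<and> (\<forall>w\<in>F (Suc n). decides (e n) w))"
  proof (rule dependent_nat_choice)
    have "matching R A B {(A, B)}" using AB by (intro matchingI) auto
    then show "\<exists>F. matching R A B F" by blast
  qed (use step in blast)
  then obtain F where F: "\<And>n. matching R A B (F n)" and ref: "\<And>n. refines (F (Suc n)) (F n)"
    and dec: "\<And>n w. w \<in> F (Suc n) \<Longrightarrow> decides (e n) w" by blast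
  define H where "H = (\<Union>n. F n)"
  have HR: "R P Q" if "(P, Q) \<in> H" for P Q
    using that matchingD(2)[OF F] unfolding H_def by fastforce
  have Aco: "A \<in> compact_opens W" and Bco: "B \<in> compact_opens W" using R[OF AB] by auto
  have baseA: "\<exists>P Q. (P, Q) \<in> H \<and> a \<in> P \<and> P \<subseteq> U" if U: "openin W U" "a \<in> U" "U \<subseteq> A" for a U
  proof -
    obtain K where K: "K \<in> compact_opens W" "a \<in> K" "K \<subseteq> U" using co_base[OF U(1,2)] by blast
    obtain n where n: "e n = K" using e_surj[OF K(1)] by blast
    have "a \<in> A" using U by blast
    then obtain w where w: "w \<in> F (Suc n)" "a \<in> fst w" using matchingD(3)[OF F[of "Suc n"]] by blast
    then have "fst w \<subseteq> K" using dec[OF w(1)] K(2) n by (auto simp: decides_def)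
    moreover have "(fst w, snd w) \<in> H" using w(1) by (auto simp: H_def)
    ultimately show ?thesis using w(2) K(3) by blast
  qed
  have baseB: "\<exists>P Q. (P, Q) \<in> H \<and> b \<in> Q \<and> Q \<subseteq> U" if U: "openin W U" "b \<in> U" "U \<subseteq> B" for b U
  proof -
    obtain K where K: "K \<in> compact_opens W" "b \<in> K" "K \<subseteq> U" using co_base[OF U(1,2)] by blast
    obtain n where n: "e n = K" using e_surj[OF K(1)] by blast
    have "b \<in> B" using U by blast
    then obtain w where w: "w \<in> F (Suc n)" "b \<in> snd w" using matchingD(4)[OF F[of "Suc n"]] by blast
    then have "snd w \<subseteq> K" using dec[OF w(1)] K(2) n by (auto simp: decides_def)
    moreover have "(fst w, snd w) \<in> H" using w(1) by (auto simp: H_def)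
    ultimately show ?thesis using w(2) K(3) by blast
  qed
  have "\<exists>f. homeo_on f A B \<and> (\<forall>P Q. (P, Q) \<in> H \<longrightarrow> f ` P = Q)"
  proof (rule homeo_from_pairs[of A B H])
    show "openin W A" "openin W B" using Aco Bco co_open by auto
    show "openin W P \<and> openin W Q \<and> P \<subseteq> A \<and> Q \<subseteq> B" if PQ: "(P, Q) \<in> H" for P Q
    proof -
      obtain n where n: "(P, Q) \<in> F n" using PQ by (auto simp: H_def)
      have "P \<subseteq> A" "Q \<subseteq> B" using matchingD(3,4)[OF F[of n]] n by force+
      then show ?thesis using R[OF HR[OF PQ]] co_open by simp
    qed
    show "\<exists>b\<in>B. \<forall>P Q. (P, Q) \<in> H \<longrightarrow> (a \<in> P \<longleftrightarrow> b \<in> Q)" if a: "a \<in> A" for a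
    proof -
      have "\<exists>b\<in>B. \<forall>n. \<forall>z\<in>F n. a \<in> fst z \<longleftrightarrow> b \<in> snd z"
        by (rule matching_sequence_partner[where R = R and F = F, OF F ref _ a]) (simp add: R)
      then obtain b where b: "b \<in> B" "\<forall>n. \<forall>z\<in>F n. a \<in> fst z \<longleftrightarrow> b \<in> snd z" by blast
      have "a \<in> P \<longleftrightarrow> b \<in> Q" if "(P, Q) \<in> H" for P Q
      proof -
        obtain n where "(P, Q) \<in> F n" using \<open>(P, Q) \<in> H\<close> by (auto simp: H_def)
        from bspec[OF spec[OF b(2)] this] show ?thesis by simp
      qed
      then show ?thesis using b(1) by (intro bexI[of _ b]) simp_all
    qed
    show "\<exists>a\<in>A. \<forall>P Q. (P, Q) \<in> H \<longrightarrow> (a \<in> P \<longleftrightarrow> b \<in> Q)" if b: "b \<in> B" for b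
    proof -
      have "\<exists>a\<in>A. \<forall>n. \<forall>z\<in>prod.swap ` F n. b \<in> fst z \<longleftrightarrow> a \<in> snd z"
        by (rule matching_sequence_partner[where R = "\<lambda>P Q. R Q P" and F = "\<lambda>n. prod.swap ` F n",
              OF matching_swap[OF F] refines_swap[OF ref] _ b]) (simp add: R)
      then obtain a where a: "a \<in> A" "\<forall>n. \<forall>z\<in>prod.swap ` F n. b \<in> fst z \<longleftrightarrow> a \<in> snd z" by blast
      have "a \<in> P \<longleftrightarrow> b \<in> Q" if "(P, Q) \<in> H" for P Q
      proof -
        obtain n where "(P, Q) \<in> F n" using \<open>(P, Q) \<in> H\<close> by (auto simp: H_def)
        then have "prod.swap (P, Q) \<in> prod.swap ` F n" by (rule imageI)
        from bspec[OF spec[OF a(2)] this] show ?thesis by simp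
      qed
      then show ?thesis using a(1) by (intro bexI[of _ a]) simp_all
    qed
  qed (use baseA baseB in auto)
  then obtain f where f: "homeo_on f A B" and fH: "\<And>P Q. (P, Q) \<in> H \<Longrightarrow> f ` P = Q" by blast
  have inj: "inj_on f A" and fA: "f ` A = B" using f by (auto simp: homeo_on_def bij_betw_def)
  have "f p = q"
  proof (rule ccontr)
    assume ne: "f p \<noteq> q"
    have "openin W (B - {q})" "f p \<in> B - {q}" "B - {q} \<subseteq> B"
      using openin_delete[OF co_open[OF Bco]] fA pq(1) ne by auto
    from baseB[OF this] obtain P Q where PQ: "(P, Q) \<in> H" "f p \<in> Q" "Q \<subseteq> B - {q}" by blast
    obtain n where n: "(P, Q) \<in> F n" using PQ(1) by (auto simp: H_def)
    have "P \<subseteq> A" using matchingD(3)[OF F[of n]] n by force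
    then have "p \<in> P" using inj_on_image_mem_iff[OF inj pq(1)] PQ(2) unfolding fH[OF PQ(1), symmetric] by simp
    then show False using pq(3)[OF HR[OF PQ(1)]] PQ(3) by blast
  qed
  then show ?thesis using f by blast
qed

section \<open>Atoms are orbits\<close>

lemma cone_decomposition:
  assumes prim: "primitive_space W" and P: "P \<in> compact_opens W" and K: "K \<in> compact_opens W"
  shows "\<exists>\<C>. finite \<C> \<and> (\<forall>C\<in>\<C>. \<forall>D\<in>\<C>. C \<noteq> D \<longrightarrow> C \<inter> D = {}) \<and> \<Union>\<C> = P \<and>
    (\<forall>C\<in>\<C>. cone C \<and> (C \<subseteq> K \<or> C \<inter> K = {}))"
proof -
  have dec: "\<exists>\<C>. finite \<C> \<and> (\<forall>C\<in>\<C>. \<forall>D\<in>\<C>. C \<noteq> D \<longrightarrow> C \<inter> D = {}) \<and> \<Union>\<C> = M \<and> (\<forall>C\<in>\<C>. cone C)"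
    if M: "M \<in> compact_opens W" for M
  proof -
    from prim[unfolded primitive_space_def, rule_format, OF M] obtain \<F>
      where \<F>: "finite \<F>" "disjoint \<F>" "\<forall>P\<in>\<F>. pseudo_indecomposable W P" "\<Union>\<F> = M"
      by blast
    show ?thesis
    proof (intro exI[of _ "\<F> - {{}}"] conjI)
      show "\<forall>C\<in>\<F> - {{}}. \<forall>D\<in>\<F> - {{}}. C \<noteq> D \<longrightarrow> C \<inter> D = {}"
        using \<F>(2) by (auto simp: disjoint_def)
      show "\<forall>C\<in>\<F> - {{}}. cone C" using \<F>(3) pseudo_indecomposable_imp_cone by simp
      show "\<Union>(\<F> - {{}}) = M" using \<F>(4) by auto
      show "finite (\<F> - {{}})" using \<F>(1) by simp
    qed
  qed
  obtain \<C>1 where 1: "finite \<C>1" "\<forall>C\<in>\<C>1. \<forall>D\<in>\<C>1. C \<noteq> D \<longrightarrow> C \<inter> D = {}" "\<Union>\<C>1 = P \<inter> K" "\<forall>C\<in>\<C>1. cone C"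
    using dec[OF co_Int[OF P K]] by (elim exE conjE)
  obtain \<C>2 where 2: "finite \<C>2" "\<forall>C\<in>\<C>2. \<forall>D\<in>\<C>2. C \<noteq> D \<longrightarrow> C \<inter> D = {}" "\<Union>\<C>2 = P - K" "\<forall>C\<in>\<C>2. cone C"
    using dec[OF co_Diff[OF P K]] by (elim exE conjE)
  have in1: "C \<subseteq> K" if "C \<in> \<C>1" for C using that 1(3) by blast
  have in2: "C \<inter> K = {}" if "C \<in> \<C>2" for C using that 2(3) by blast
  show ?thesis
  proof (intro exI[of _ "\<C>1 \<union> \<C>2"] conjI)
    show "finite (\<C>1 \<union> \<C>2)" using 1(1) 2(1) by simp
    show "\<Union>(\<C>1 \<union> \<C>2) = P" using 1(3) 2(3) by auto
    show "\<forall>C\<in>\<C>1 \<union> \<C>2. cone C \<and> (C \<subseteq> K \<or> C \<inter> K = {})"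
      using 1(4) 2(4) in1 in2 by blast
    show "\<forall>C\<in>\<C>1 \<union> \<C>2. \<forall>D\<in>\<C>1 \<union> \<C>2. C \<noteq> D \<longrightarrow> C \<inter> D = {}"
    proof (intro ballI impI)
      fix C D assume "C \<in> \<C>1 \<union> \<C>2" "D \<in> \<C>1 \<union> \<C>2" and ne: "C \<noteq> D"
      then consider "C \<in> \<C>1" "D \<in> \<C>1" | "C \<in> \<C>2" "D \<in> \<C>2" | "C \<in> \<C>1" "D \<in> \<C>2" | "C \<in> \<C>2" "D \<in> \<C>1"
        by blast
      then show "C \<inter> D = {}"
      proof cases
        case 1 then show ?thesis using \<open>\<forall>C\<in>\<C>1. \<forall>D\<in>\<C>1. C \<noteq> D \<longrightarrow> C \<inter> D = {}\<close> ne by simp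
      next
        case 2 then show ?thesis using \<open>\<forall>C\<in>\<C>2. \<forall>D\<in>\<C>2. C \<noteq> D \<longrightarrow> C \<inter> D = {}\<close> ne by simp
      next
        case 3 then show ?thesis using in1[OF 3(1)] in2[OF 3(2)] by blast
      next
        case 4 then show ?thesis using in1[OF 4(2)] in2[OF 4(1)] by blast
      qed
    qed
  qed
qed

text \<open>The relation for the back-and-forth argument that takes \<open>x\<close> to \<open>y\<close>; the last condition carries the
mark.\<close>
definition similar :: "'a \<Rightarrow> 'a \<Rightarrow> 'a set \<Rightarrow> 'a set \<Rightarrow> bool"
  where "similar x y P Q \<longleftrightarrow> cone P \<and> cone Q \<and> sat P = sat Q \<and> (x \<in> P \<longleftrightarrow> y \<in> Q)"

lemma similar_sym: "similar x y P Q \<longleftrightarrow> similar y x Q P"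
  by (auto simp: similar_def)

lemma similar_split:
  assumes prim: "primitive_space W" and xy: "x \<sim> y" and PQ: "similar x y P Q"
    and K: "K \<in> compact_opens W"
  shows "\<exists>G. matching (similar x y) P Q G \<and> (\<forall>w\<in>G. fst w \<subseteq> K \<or> fst w \<inter> K = {})"
proof -
  have P: "cone P" "cone Q" "sat P = sat Q" "x \<in> P \<longleftrightarrow> y \<in> Q" using PQ by (auto simp: similar_def)
  then have "P \<in> compact_opens W" by (simp add: cone_def)
  from cone_decomposition[OF prim this K] obtain \<C>
    where fin: "finite \<C>" and disj: "\<forall>C\<in>\<C>. \<forall>D\<in>\<C>. C \<noteq> D \<longrightarrow> C \<inter> D = {}" and un: "\<Union>\<C> = P"
      and cones: "\<forall>C\<in>\<C>. cone C \<and> (C \<subseteq> K \<or> C \<inter> K = {})" by (elim exE conjE)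
  have "\<exists>\<beta>. (\<forall>C\<in>\<C>. cone (\<beta> C) \<and> sat (\<beta> C) = sat C \<and> (x \<in> C \<longleftrightarrow> y \<in> \<beta> C)) \<and>
      (\<forall>C\<in>\<C>. \<forall>D\<in>\<C>. C \<noteq> D \<longrightarrow> \<beta> C \<inter> \<beta> D = {}) \<and> (\<Union>C\<in>\<C>. \<beta> C) = Q"
    by (rule cone_partition_transfer[OF xy P fin _ un]) (use disj cones in simp_all)
  then obtain \<beta> where
    \<beta>: "\<forall>C\<in>\<C>. cone (\<beta> C) \<and> sat (\<beta> C) = sat C \<and> (x \<in> C \<longleftrightarrow> y \<in> \<beta> C)"
    and \<beta>_disj: "\<forall>C\<in>\<C>. \<forall>D\<in>\<C>. C \<noteq> D \<longrightarrow> \<beta> C \<inter> \<beta> D = {}"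
    and \<beta>_un: "(\<Union>C\<in>\<C>. \<beta> C) = Q" by (elim exE conjE)
  let ?G = "(\<lambda>C. (C, \<beta> C)) ` \<C>"
  have "matching (similar x y) P Q ?G"
  proof (rule matchingI)
    show "finite ?G" using fin by simp
    show "similar x y (fst z) (snd z)" if "z \<in> ?G" for z
      using that \<beta> cones by (auto simp: similar_def)
    show "\<Union>(fst ` ?G) = P" "\<Union>(snd ` ?G) = Q" using un \<beta>_un by (simp_all add: image_image)
    fix z w p assume "z \<in> ?G" "w \<in> ?G"
    then obtain C D where CD: "C \<in> \<C>" "D \<in> \<C>" "z = (C, \<beta> C)" "w = (D, \<beta> D)" by blast
    have C: "C = D \<or> C \<inter> D = {} \<and> \<beta> C \<inter> \<beta> D = {}" using CD(1,2) disj \<beta>_disj by metis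
    show "z = w" if "p \<in> fst z" "p \<in> fst w" using that C CD(3,4) by auto
    show "z = w" if "p \<in> snd z" "p \<in> snd w" using that C CD(3,4) by auto
  qed
  moreover have "\<forall>w\<in>?G. fst w \<subseteq> K \<or> fst w \<inter> K = {}" using cones by simp
  ultimately show ?thesis by blast
qed

text \<open>Any cone \<open>A\<close> that contains \<open>x\<close> but not \<open>y\<close> can serve as the left side. The right side is a
neighbourhood of \<open>y\<close> disjoint from \<open>A\<close>, or the union of such a neighbourhood with \<open>A\<close> itself; in
the second case \<open>A\<close> is mapped onto a proper superset.\<close>
lemma insep_imp_homeomorphic:
  assumes count: "countable (compact_opens W)" and prim: "primitive_space W" and xy: "x \<sim> y"
  shows "\<exists>h. homeomorphic_map W W h \<and> h x = y"
proof (cases "x = y")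
  case True
  then show ?thesis by (intro exI[of _ id]) simp
next
  case False
  have "openin W (topspace W - {y})" by (rule openin_delete) simp
  moreover have "x \<in> topspace W - {y}" using insep_topspace[OF xy] False by simp
  ultimately have "\<exists>K. K \<in> compact_opens W \<and> x \<in> K \<and> K \<subseteq> topspace W - {y}"
    by (rule co_base)
  then obtain K where K: "K \<in> compact_opens W" "x \<in> K" "K \<subseteq> topspace W - {y}"
    by (elim exE conjE)
  from cone_decomposition[OF prim K(1) K(1)] obtain \<C>
    where \<C>: "\<Union>\<C> = K" "\<forall>C\<in>\<C>. cone C \<and> (C \<subseteq> K \<or> C \<inter> K = {})" by (elim exE conjE)
  from K(2) \<C>(1) obtain A where "A \<in> \<C>" "x \<in> A" by blast
  then have A: "cone A" "x \<in> A" "y \<notin> A" using \<C> K(3) by auto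
  then have Aco: "A \<in> compact_opens W" by (simp add: cone_def)
  have V: "openin W (topspace W - A)" "y \<in> topspace W - A"
    using co_closed[OF Aco] insep_topspace[OF xy] A(3) by auto
  from cone_absorbing_point[OF A(1,2) xy V] obtain D where D: "y \<in> D"
    and absorb: "\<forall>E. cone E \<longrightarrow> sat E = sat A \<longrightarrow>
      (\<exists>G. (G = D \<or> G = D \<union> E) \<and> cone G \<and> sat G = sat A)" by (elim exE conjE)
  from absorb A(1) obtain B where B: "B = D \<or> B = D \<union> A" "cone B" "sat B = sat A" by blast
  have yB: "y \<in> B" using B(1) D by blast
  have AB: "similar x y A B" using A B yB by (simp add: similar_def)
  have co: "P \<in> compact_opens W \<and> Q \<in> compact_opens W \<and> P \<noteq> {} \<and> Q \<noteq> {}" if "similar x y P Q" for P Q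
    using that tip_mem by (auto simp: similar_def cone_def)
  have "\<exists>f. homeo_on f A B \<and> f x = y"
  proof (rule back_and_forth[where R = "similar x y", OF count AB co similar_split[OF prim xy] _ A(2) yB])
    fix P Q K assume PQ: "similar x y P Q" and K: "K \<in> compact_opens W"
    have "similar y x Q P" using PQ similar_sym by blast
    from similar_split[OF prim insep_sym[OF xy] this K] obtain G where
      G: "matching (similar y x) Q P G" "\<forall>w\<in>G. fst w \<subseteq> K \<or> fst w \<inter> K = {}" by blast
    have "(\<lambda>P Q. similar y x Q P) = similar x y" by (intro ext) (rule similar_sym[symmetric])
    then have "matching (similar x y) P Q (prod.swap ` G)" using matching_swap[OF G(1)] by simp
    moreover have "\<forall>w\<in>prod.swap ` G. snd w \<subseteq> K \<or> snd w \<inter> K = {}" using G(2) by simp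
    ultimately show "\<exists>G. matching (similar x y) P Q G \<and> (\<forall>w\<in>G. snd w \<subseteq> K \<or> snd w \<inter> K = {})" by blast
  next
    show "x \<in> P \<longleftrightarrow> y \<in> Q" if "similar x y P Q" for P Q using that by (simp add: similar_def)
  qed
  then obtain f where f: "homeo_on f A B" "f x = y" by blast
  have "openin W A" "openin W B" using Aco B(2) co_open by (auto simp: cone_def)
  then show ?thesis using homeo_on_extends_globally[OF f(1) _ _ A(2)] f(2) by metis
qed

lemma set_atoms_prime_TBA: "set_atoms (prime_TBA W) = (\<lambda>x. sat {x}) ` topspace W"
proof (intro equalityI subsetI)
  fix A assume A: "A \<in> set_atoms (prime_TBA W)"
  then obtain x where x: "x \<in> A" by (auto simp: set_atoms_def)
  have A': "A \<in> prime_TBA W" "\<And>B. B \<in> prime_TBA W \<Longrightarrow> B \<subseteq> A \<Longrightarrow> B = {} \<or> B = A"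
    using A by (auto simp: set_atoms_def)
  have xt: "x \<in> topspace W" using x TBA_subset[OF A'(1)] by blast
  have "sat {x} \<subseteq> A" using insep_mem[OF _ A'(1)] x by (auto simp: sat_singleton)
  moreover have "x \<in> sat {x}" using insep_refl[OF xt] by (simp add: sat_singleton)
  ultimately have "sat {x} = A" using A'(2)[OF sat_singleton_in_TBA] by blast
  then show "A \<in> (\<lambda>x. sat {x}) ` topspace W" using xt by blast
next
  fix A assume "A \<in> (\<lambda>x. sat {x}) ` topspace W"
  then obtain x where x: "x \<in> topspace W" "A = sat {x}" by blast
  have "x \<in> A" using x insep_refl by (simp add: sat_singleton)
  moreover have "B = {} \<or> B = A" if B: "B \<in> prime_TBA W" "B \<subseteq> A" for B
  proof (cases "x \<in> B")
    case True
    then have "A \<subseteq> B" using insep_mem[OF _ B(1)] x(2) by (auto simp: sat_singleton)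
    then show ?thesis using B(2) by blast
  next
    case False
    have "z \<notin> B" for z
      using False insep_mem[OF _ B(1)] B(2) x(2) by (auto simp: sat_singleton)
    then show ?thesis by blast
  qed
  ultimately show "A \<in> set_atoms (prime_TBA W)"
    using sat_singleton_in_TBA x(2) by (auto simp: set_atoms_def)
qed

end

theorem theorem4p28:
  fixes W :: "'a topology"
  assumes "omega_stone_space W"
    and "primitive_space W"
  shows "set_atoms (prime_TBA W) = homeo_orbits W \<and> prime_TBA W = homeo_invariant_sets W"
proof -
  interpret stone W
    using assms(1) by unfold_locales (simp add: omega_stone_space_def)
  have count: "countable (compact_opens W)" using assms(1) by (simp add: omega_stone_space_def)
  have orbit: "sat {x} = {f x |f. homeomorphic_map W W f}" if x: "x \<in> topspace W" for x
  proof (intro equalityI subsetI)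
    fix y assume "y \<in> sat {x}"
    then have "inseparable x y" by (simp add: sat_singleton)
    then show "y \<in> {f x |f. homeomorphic_map W W f}"
      using insep_imp_homeomorphic[OF count assms(2)] by blast
  next
    fix y assume "y \<in> {f x |f. homeomorphic_map W W f}"
    then show "y \<in> sat {x}" using homeomorphic_map_insep[OF _ x] by (auto simp: sat_singleton)
  qed
  have "set_atoms (prime_TBA W) = homeo_orbits W"
    unfolding set_atoms_prime_TBA homeo_orbits_def using orbit by (intro image_cong) auto
  moreover have "homeo_invariant_sets W \<subseteq> prime_TBA W"
  proof
    fix S assume S: "S \<in> homeo_invariant_sets W"
    then have Ssub: "S \<subseteq> topspace W" by (simp add: homeo_invariant_sets_def)
    have "y \<in> S" if x: "x \<in> S" and y: "inseparable x y" for x y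
    proof -
      obtain h where h: "homeomorphic_map W W h" "h x = y"
        using insep_imp_homeomorphic[OF count assms(2) y] by blast
      then have "h ` S = S" using S by (simp add: homeo_invariant_sets_def)
      then show ?thesis using x h(2) by blast
    qed
    then have "sat S = S" using subset_sat[OF Ssub] by (auto simp: sat_def)
    then show "S \<in> prime_TBA W" using sat_in_TBA[of S] by simp
  qed
  ultimately show ?thesis using prime_TBA_subset_invariant by blast
qed

end
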